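(* Let $r\in(1,2]$, $L>0$, $\sigma>0$, and consider $y_i=f(x_i)+\sigma\epsilon_i$, $x_i=i/n$, $i=1,\dots,n$, with $\epsilon_i$ independent standard normal. Let $\hat f^{[1]}$ be the convex $P$-spline estimator defined in the context. If $K_n$ and $\lambda^*$ are chosen as $$K_n=\left\lceil\Big(\frac n{\log n}\Big)^{\frac1{2r+1}}\right\rceil,\qquad \lambda^*=\beta_n\,K_n^{-1},$$ then there exists a positive constant $C_0$ (dependent on $\sigma,L,r$ only) such that $$\sup_{f\in\mathcal C_H(r,L)}\mathbb E\Big(\|\hat f^{[1]}-f\|_\infty\Big)\le C_0\Big(\frac{\log n}n\Big)^{\frac r{2r+1}}$$ for all sufficiently large $n$ (for which $n/K_n$ is an integer).
   Context: $\mathcal C_H(r,L)$ is the set of differentiable convex functions $f:[0,1]\to\mathbb R$ with $|f'(x_1)-f'(x_2)|\le L|x_1-x_2|^{r-1}$ for all $x_1,x_2\in[0,1]$. $\|g\|_\infty=\sup_{x\in[0,1]}|g(x)|$. Standing assumption: $K_n\ge2$ and $n/K_n$ is an integer. The linear B-spline basis with knots $k/K_n$ is $B^{[1]}_k(x)=\max\{0,\,1-|K_nx-(k-1)|\}$, $x\in[0,1]$, $k=1,\dots,K_n+1$. Let $X=[B^{[1]}_k(x_i)]_{i,k}\in\mathbb R^{n\times(K_n+1)}$, $\beta_n:=\sum_{i=1}^n(B^{[1]}_k(x_i))^2$ for $k\in\{2,\dots,K_n\}$ (independent of such $k$), $\Gamma:=X^TX/\beta_n$. Let $D_2\in\mathbb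 R^{(K_n-1)\times(K_n+1)}$ be given by $(D_2b)_i=b_i-2b_{i+1}+b_{i+2}$, $\Omega:=\{b\in\mathbb R^{K_n+1}:D_2b\ge0\}$ (componentwise), and for a penalty parameter $\lambda^*>0$ put $\lambda:=\lambda^*/\beta_n$, $\Lambda:=\Gamma+\lambda D_2^TD_2$. With $y=(y_1,\dots,y_n)^T$ and $\bar y:=X^Ty/\beta_n$, let $$\hat b:=\arg\min_{b\in\Omega}\tfrac12b^T\Lambda b-b^T\bar y$$ (equivalently, the minimizer over $\Omega$ of $\sum_{i=1}^n(y_i-\sum_kb_kB^{[1]}_k(x_i))^2+\lambda^*\|D_2b\|_2^2$), and $\hat f^{[1]}(x):=\sum_{k=1}^{K_n+1}\hat b_kB^{[1]}_k(x)$. *)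

theory Defs
  imports "HOL-Probability.Probability" "Jordan_Normal_Form.Matrix"
begin

unbundle no inner_syntax and no vec_syntax

hide_type (open) Finite_Cartesian_Product.vec

text \<open>
  Elements are total functions on the reals of which only the restriction to \<open>[0,1]\<close> matters;
  differentiability is one-sided at the end points.
\<close>

definition convex_holder :: "real \<Rightarrow> real \<Rightarrow> (real \<Rightarrow> real) set" where
  "convex_holder r L = {f. convex_on {0..1} f \<and>
     (\<exists>f'. (\<forall>x\<in>{0..1}. (f has_real_derivative f' x) (at x within {0..1})) \<and>
           (\<forall>x1\<in>{0..1}. \<forall>x2\<in>{0..1}. \<bar>f' x1 - f' x2\<bar> \<le> L * \<bar>x1 - x2\<bar> powr (r - 1)))}"

definition sup_norm :: "(real \<Rightarrow> real) \<Rightarrow> ennreal" where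
  "sup_norm g = (SUP x\<in>{0..1}. ennreal \<bar>g x\<bar>)"

definition bspline :: "nat \<Rightarrow> nat \<Rightarrow> real \<Rightarrow> real" where
  "bspline K k x = max 0 (1 - \<bar>real K * x - (real k - 1)\<bar>)"

definition design_pt :: "nat \<Rightarrow> nat \<Rightarrow> real" where
  "design_pt n i = real i / real n"

text \<open>
  Vectors and matrices are indexed from \<open>0\<close>, whereas B-splines, design points and errors are
  numbered from \<open>1\<close>.
\<close>

definition design_mat :: "nat \<Rightarrow> nat \<Rightarrow> real mat" where
  "design_mat n K = mat n (K + 1) (\<lambda>(i, k). bspline K (k + 1) (design_pt n (i + 1)))"

text \<open>
  The index \<open>2\<close> stands for an arbitrary \<open>k \<in> {2..K}\<close>, see \<open>beta_indep\<close> below.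
\<close>

definition beta :: "nat \<Rightarrow> nat \<Rightarrow> real" where
  "beta n K = (\<Sum>i=1..n. (bspline K 2 (design_pt n i))\<^sup>2)"

lemma beta_indep:
  assumes "K dvd n" and "n > 0" and k: "k \<in> {2..K}"
  shows "(\<Sum>i=1..n. (bspline K k (design_pt n i))\<^sup>2) = beta n K"
proof -
  obtain m where n: "n = K * m" using assms(1) by (elim dvdE)
  have K: "K > 0" and m: "m > 0" using n assms(2) by auto
  define h where "h z = (max 0 (1 - \<bar>real_of_int z / real m\<bar>))\<^sup>2" for z :: int
  have eq: "(bspline K j (design_pt n i))\<^sup>2 = h (int i - int m * (int j - 1))" for i j
    using K m by (simp add: bspline_def design_pt_def h_def n diff_divide_distrib)
  have h0: "h z = 0" if "z \<notin> {- int m<..<int m}" for z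
  proof -
    have "\<bar>real_of_int z\<bar> \<ge> real m" using that by auto
    then have "\<bar>real_of_int z / real m\<bar> \<ge> 1" using m by (simp add: field_simps)
    then show ?thesis by (simp add: h_def)
  qed
  have gen: "(\<Sum>i=1..n. (bspline K j (design_pt n i))\<^sup>2) = sum h {- int m<..<int m}"
    if j: "j \<in> {2..K}" for j
  proof -
    define c where "c = int m * (int j - 1)"
    let ?g = "\<lambda>i. int i - c"
    have "int m * 1 \<le> int m * (int j - 1)" by (rule mult_left_mono) (use j in auto)
    then have lo: "int m \<le> c" by (simp add: c_def)
    have "int m * int j \<le> int m * int K" by (rule mult_left_mono) (use j in auto)
    then have hi: "c + int m \<le> int n" by (simp add: c_def n algebra_simps)
    have "(\<Sum>i=1..n. (bspline K j (design_pt n i))\<^sup>2) = (\<Sum>i=1..n. h (?g i))"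
      by (simp add: eq c_def)
    also have "\<dots> = sum h (?g ` {1..n})"
      by (subst sum.reindex) (auto simp: inj_on_def)
    also have "\<dots> = sum h {- int m<..<int m}"
    proof (rule sum.mono_neutral_right)
      show "{- int m<..<int m} \<subseteq> ?g ` {1..n}"
      proof
        fix z assume "z \<in> {- int m<..<int m}"
        then show "z \<in> ?g ` {1..n}" using lo hi
          by (intro image_eqI[of _ _ "nat (z + c)"]) auto
      qed
    qed (use h0 in auto)
    finally show ?thesis .
  qed
  show ?thesis unfolding beta_def using gen[OF k] gen[of 2] k by simp
qed

definition Gram :: "nat \<Rightarrow> nat \<Rightarrow> real mat" where
  "Gram n K = (1 / beta n K) \<cdot>\<^sub>m (transpose_mat (design_mat n K) * design_mat n K)"

definition diff2_mat :: "nat \<Rightarrow> real mat" where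
  "diff2_mat K = mat (K - 1) (K + 1)
     (\<lambda>(i, j). if j = i then 1 else if j = i + 1 then - 2 else if j = i + 2 then 1 else 0)"

definition convex_coeffs :: "nat \<Rightarrow> real vec set" where
  "convex_coeffs K = {b \<in> carrier_vec (K + 1). 0\<^sub>v (K - 1) \<le> diff2_mat K *\<^sub>v b}"

definition penalized_Gram :: "nat \<Rightarrow> nat \<Rightarrow> real \<Rightarrow> real mat" where
  "penalized_Gram n K lam_star = Gram n K +
     (lam_star / beta n K) \<cdot>\<^sub>m (transpose_mat (diff2_mat K) * diff2_mat K)"

definition weighted_response :: "nat \<Rightarrow> nat \<Rightarrow> real vec \<Rightarrow> real vec" where
  "weighted_response n K y = (1 / beta n K) \<cdot>\<^sub>v (transpose_mat (design_mat n K) *\<^sub>v y)"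

definition coeff_estimator :: "nat \<Rightarrow> nat \<Rightarrow> real \<Rightarrow> real vec \<Rightarrow> real vec" where
  "coeff_estimator n K lam_star y =
     (ARG_MIN (\<lambda>b. 1/2 * (b \<bullet> (penalized_Gram n K lam_star *\<^sub>v b)) - b \<bullet> weighted_response n K y) b.
        b \<in> convex_coeffs K)"

definition pspline_estimator :: "nat \<Rightarrow> nat \<Rightarrow> real \<Rightarrow> real vec \<Rightarrow> real \<Rightarrow> real" where
  "pspline_estimator n K lam_star y x =
     (\<Sum>k=1..K+1. coeff_estimator n K lam_star y $ (k - 1) * bspline K k x)"

definition observations :: "nat \<Rightarrow> (real \<Rightarrow> real) \<Rightarrow> real \<Rightarrow> (nat \<Rightarrow> real) \<Rightarrow> real vec" where
  "observations n f \<sigma> e = vec n (\<lambda>i. f (design_pt n (i + 1)) + \<sigma> * e (i + 1))"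

definition std_normal_errors :: "'a measure \<Rightarrow> nat \<Rightarrow> (nat \<Rightarrow> 'a \<Rightarrow> real) \<Rightarrow> bool" where
  "std_normal_errors M n eps \<longleftrightarrow>
     prob_space.indep_vars M (\<lambda>_. borel) eps {1..n} \<and>
     (\<forall>i\<in>{1..n}. distributed M lborel (eps i) (\<lambda>x. ennreal (std_normal_density x)))"

definition num_knots :: "real \<Rightarrow> nat \<Rightarrow> nat" where
  "num_knots r n = nat \<lceil>(real n / ln (real n)) powr (1 / (2 * r + 1))\<rceil>"

definition penalty_param :: "nat \<Rightarrow> nat \<Rightarrow> real" where
  "penalty_param n K = beta n K * inverse (real K)"

end

theory Submission
  imports Defs "HOL-Real_Asymp.Real_Asymp"
begin

text \<open>
  Let \<open>a\<close> be the knot values of \<open>f\<close>, let \<open>b\<close> be the estimated coefficients and \<open>u = b - a\<close>, with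
  maximum \<open>M\<close> and minimum \<open>-R\<close>. The uniform bound on \<open>u\<close> comes from testing the variational
  inequality of the constrained minimum with two hat functions only.
  The first minimum of \<open>u\<close> is at a kink of \<open>b\<close> or at an end point (between kinks \<open>b\<close> is affine, so
  \<open>u\<close> is concave), hence the unit hat there is an admissible direction; as a unit hat puts more
  than half of its mass under its own square, this bounds \<open>R\<close> by a fixed fraction of \<open>M\<close>, up to the error
  terms. At a maximum of \<open>u\<close> the negative of the hat reaching to the neighbouring kinks on either
  side is admissible; \<open>u\<close> lies above the hat that interpolates \<open>M\<close> and \<open>-R\<close> there, so
  \<open>M\<close> is at most a fraction of \<open>R\<close>, up to the error terms. The two fractions multiply to less than \<open>1\<close>.
  The noise enters only through its inner products with the B-splines, whose maximum is controlled by
  exponential moments.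
\<close>

section \<open>Piecewise linear interpolation and hat functions\<close>

text \<open>The obstacle is that the kinks of \<open>b\<close> depend on the noise, so the hats used
  at a maximum of \<open>u\<close> have random position and length. All estimates are therefore made
  relative to the total mass \<open>S\<close> of the hat over the design points, and
  \<open>S\<close> is divided out at the end. For the noise this works because every hat is a
  nonnegative combination of unit hats: its ratio of noise to mass is controlled by the
  \<open>K + 1\<close> unit hats alone. The two tests differ because adding a hat can violate
  convexity only at its peak, subtracting it only at its feet. An interior first minimum of
  \<open>u\<close> provides a kink at the peak; at a maximum the feet have to be moved out to kinks.
  If \<theta> is the guaranteed share of the square in the mass, the tests bound
  \<open>\<theta> M - (1 - \<theta>) R\<close> and \<open>\<theta> R - (1 - \<theta>) M\<close>, and
  their sum is \<open>(2 \<theta> - 1) (M + R)\<close>, whence the threshold \<open>1/2\<close>. The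
  surplus also has to absorb the penalty at the minimum, where the curvature of \<open>b\<close> is
  controlled only through \<open>M + R\<close>; this is the origin of
  \<open>100 \<le> K\<close>.\<close>

text \<open>The argument \<open>z\<close> is \<open>K x\<close>, so that the knots are the integers \<open>0, \<dots>, K\<close>.\<close>

definition pl :: "nat \<Rightarrow> (nat \<Rightarrow> real) \<Rightarrow> real \<Rightarrow> real" where
  "pl K b z = (\<Sum>k\<le>K. b k * max 0 (1 - \<bar>z - real k\<bar>))"

text \<open>Meant for interior knots. At \<open>k = 0\<close> the truncated subtraction turns it
  into \<open>b 1 - b 0\<close>, so the constraints are imposed on \<open>{1..<K}\<close>
  only.\<close>

definition diff2 :: "(nat \<Rightarrow> real) \<Rightarrow> nat \<Rightarrow> real" where
  "diff2 b k = b (k - 1) - 2 * b k + b (k + 1)"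

lemma pl_cell:
  assumes "j < K" "real j \<le> z" "z \<le> real j + 1"
  shows "pl K b z = (1 - (z - real j)) * b j + (z - real j) * b (j + 1)"
proof -
  have "pl K b z = (\<Sum>k\<in>{j, j+1}. b k * max 0 (1 - \<bar>z - real k\<bar>))"
    unfolding pl_def
  proof (rule sum.mono_neutral_right)
    show "\<forall>i\<in>{..K} - {j, j+1}. b i * max 0 (1 - \<bar>z - real i\<bar>) = 0"
    proof
      fix i assume i: "i \<in> {..K} - {j, j+1}"
      then consider "real i \<le> real j - 1" | "real i \<ge> real j + 2" by fastforce
      then have "\<bar>z - real i\<bar> \<ge> 1" using assms by cases auto
      then show "b i * max 0 (1 - \<bar>z - real i\<bar>) = 0" by simp
    qed
  qed (use assms in auto)
  also have "\<dots> = (1 - (z - real j)) * b j + (z - real j) * b (j + 1)"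
    using assms by (simp add: max_def abs_if algebra_simps)
  finally show ?thesis .
qed

lemma unit_cell:
  assumes "p < t" "real p \<le> z" "z \<le> real t"
  obtains j where "p \<le> j" "j < t" "real j \<le> z" "z \<le> real j + 1"
proof (cases "z = real t")
  case True
  \<comment> \<open>At the right end the floor would select the cell to the right of
    \<open>t\<close>, so the last cell is taken instead.\<close>
  show ?thesis by (rule that[of "t - 1"]) (use assms True in \<open>auto simp: of_nat_diff\<close>)
next
  case False
  define j where "j = nat \<lfloor>z\<rfloor>"
  have "z \<ge> 0" using assms(2) by linarith
  then have j: "real j \<le> z" "z < real j + 1" unfolding j_def by linarith+
  moreover have "p \<le> j" using assms(2) j by linarith
  moreover have "j < t" using assms(3) False j by linarith
  ultimately show ?thesis using that[of j] by auto
qed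

lemma pl_knot: "k \<le> K \<Longrightarrow> pl K b (real k) = b k"
proof -
  assume k: "k \<le> K"
  have "pl K b (real k) = (\<Sum>i\<le>K. if i = k then b k else 0)"
    unfolding pl_def
  proof (rule sum.cong[OF refl])
    fix i
    have "\<bar>real k - real i\<bar> \<ge> 1" if "i \<noteq> k"
      using that by (cases "i < k") auto
    then show "b i * max 0 (1 - \<bar>real k - real i\<bar>) = (if i = k then b k else 0)" by auto
  qed
  then show ?thesis using k by simp
qed

lemma pl_mono:
  assumes "p < t" "t \<le> K" "real p \<le> z" "z \<le> real t"
    and le: "\<And>k. p \<le> k \<Longrightarrow> k \<le> t \<Longrightarrow> b k \<le> c k"
  shows "pl K b z \<le> pl K c z"
proof -
  obtain j where j: "p \<le> j" "j < t" "real j \<le> z" "z \<le> real j + 1"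
    using unit_cell assms by metis
  show ?thesis using pl_cell[of j K z] j assms(2) le[of j] le[of "j+1"]
    by (auto intro!: add_mono mult_left_mono)
qed

lemma pl_affine:
  assumes "p < t" "t \<le> K" "real p \<le> z" "z \<le> real t"
    and eq: "\<And>k. p \<le> k \<Longrightarrow> k \<le> t \<Longrightarrow> b k = \<alpha> + \<gamma> * real k"
  shows "pl K b z = \<alpha> + \<gamma> * z"
proof -
  obtain j where j: "p \<le> j" "j < t" "real j \<le> z" "z \<le> real j + 1"
    using unit_cell assms by metis
  have "pl K b z = (1 - (z - real j)) * b j + (z - real j) * b (j + 1)"
    using j assms(2) by (intro pl_cell) auto
  also have "\<dots> = \<alpha> + \<gamma> * z"
    using eq[of j] eq[of "j+1"] j by (simp add: algebra_simps)
  finally show ?thesis .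
qed

lemma pl_add: "pl K (\<lambda>k. b k + c k) z = pl K b z + pl K c z"
  by (simp add: pl_def sum.distrib algebra_simps)

lemma pl_diff: "pl K (\<lambda>k. b k - c k) z = pl K b z - pl K c z"
  by (simp add: pl_def sum_subtractf algebra_simps)

lemma pl_scale: "pl K (\<lambda>k. s * b k) z = s * pl K b z"
  by (simp add: pl_def sum_distrib_left algebra_simps)

lemma pl_uminus: "pl K (\<lambda>k. - b k) z = - pl K b z"
  using pl_scale[of K "-1" b z] by simp

lemma pl_const: "K > 0 \<Longrightarrow> 0 \<le> z \<Longrightarrow> z \<le> real K \<Longrightarrow> pl K (\<lambda>_. s) z = s"
  using pl_affine[of 0 K K z "\<lambda>_. s" s 0] by simp

definition hat :: "nat \<Rightarrow> nat \<Rightarrow> nat \<Rightarrow> nat \<Rightarrow> real" where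
  "hat p t q k =
     (if k < t then (if k \<le> p then 0 else (real k - real p) / (real t - real p))
      else if k = t then 1
      else if k \<ge> q then 0 else (real q - real k) / (real q - real t))"

text \<open>At an end point the hat is one-sided: \<open>p = t = 0\<close> or \<open>t = q = K\<close>.\<close>

definition hat_knots :: "nat \<Rightarrow> nat \<Rightarrow> nat \<Rightarrow> nat \<Rightarrow> bool" where
  "hat_knots K p t q \<longleftrightarrow> (p < t \<or> p = 0 \<and> t = 0) \<and> (t < q \<or> t = K \<and> q = K) \<and> q \<le> K"

lemma hat_nonneg: "0 \<le> hat p t q k"
  by (auto simp: hat_def)

lemma hat_le1: "hat p t q k \<le> 1"
  by (auto simp: hat_def field_simps)

lemma hat_left: "p < t \<Longrightarrow> p \<le> k \<Longrightarrow> k \<le> t \<Longrightarrow> hat p t q k = (real k - real p) / (real t - real p)"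
  by (auto simp: hat_def)

lemma hat_right: "t < q \<Longrightarrow> t \<le> k \<Longrightarrow> k \<le> q \<Longrightarrow> hat p t q k = (real q - real k) / (real q - real t)"
  by (auto simp: hat_def)

lemma diff2_affine:
  assumes "0 < k" "\<And>j. k - 1 \<le> j \<Longrightarrow> j \<le> k + 1 \<Longrightarrow> b j = \<alpha> + \<gamma> * real j"
  shows "diff2 b k = 0"
  using assms(1) assms(2)[of "k-1"] assms(2)[of k] assms(2)[of "k+1"]
  by (auto simp: diff2_def of_nat_diff algebra_simps)

text \<open>The hat is convex at its feet, concave at its peak and affine elsewhere; the constants
  use only that its values lie between \<open>0\<close> and \<open>1\<close>. The upper bound tells
  where the negative of a hat is admissible, the lower bound where the hat itself is.\<close>

lemma hat_diff2:
  assumes hk: "hat_knots K p t q" and k: "0 < k" "k < K"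
  shows "diff2 (hat p t q) k \<le> of_bool (k = p) + of_bool (k = q)"
    and "- 2 * of_bool (k = t) \<le> diff2 (hat p t q) k"
proof -
  let ?h = "hat p t q"
  have *: "diff2 ?h k \<le> of_bool (k = p) + of_bool (k = q) \<and> - 2 * of_bool (k = t) \<le> diff2 ?h k"
  proof -
    consider "k = t" | "k < p" | "k = p" "p < t" | "p < k" "k < t" | "t < k" "k < q" | "k = q" "t < q" | "q < k"
      using hk k by (auto simp: hat_knots_def) linarith+
    then show ?thesis
    proof cases
      case 1
      then have "?h k = 1" by (simp add: hat_def)
      then show ?thesis using 1 hat_nonneg[of p t q "k-1"] hat_nonneg[of p t q "k+1"]
          hat_le1[of p t q "k-1"] hat_le1[of p t q "k+1"]
        by (auto simp: diff2_def)
    next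
      case 2
      then have "diff2 ?h k = 0" using hk by (auto simp: diff2_def hat_def hat_knots_def)
      then show ?thesis by auto
    next
      case 3
      then have "?h (k - 1) = 0" "?h k = 0" using k by (auto simp: hat_def)
      then show ?thesis using 3 hat_nonneg[of p t q "k+1"] hat_le1[of p t q "k+1"]
        by (auto simp: diff2_def)
    next
      case 4
      have "diff2 ?h k = 0"
      proof (rule diff2_affine)
        fix j assume "k - 1 \<le> j" "j \<le> k + 1"
        then have "?h j = (real j - real p) / (real t - real p)" using 4 by (intro hat_left) auto
        also have "\<dots> = - real p / (real t - real p) + 1 / (real t - real p) * real j"
          by (simp add: diff_divide_distrib)
        finally show "?h j = - real p / (real t - real p) + 1 / (real t - real p) * real j" .
      qed (use k in auto)
      then show ?thesis by auto
    next
      case 5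
      have "diff2 ?h k = 0"
      proof (rule diff2_affine)
        fix j assume "k - 1 \<le> j" "j \<le> k + 1"
        then have "?h j = (real q - real j) / (real q - real t)" using 5 by (intro hat_right) auto
        also have "\<dots> = real q / (real q - real t) + (- 1 / (real q - real t)) * real j"
          by (simp add: diff_divide_distrib)
        finally show "?h j = real q / (real q - real t) + (- 1 / (real q - real t)) * real j" .
      qed (use k in auto)
      then show ?thesis by auto
    next
      case 6
      then have "?h (k + 1) = 0" "?h k = 0" using k by (auto simp: hat_def)
      then show ?thesis using 6 hat_nonneg[of p t q "k-1"] hat_le1[of p t q "k-1"]
        by (auto simp: diff2_def)
    next
      case 7
      then have "?h (k - 1) = 0" "?h k = 0" "?h (k+1) = 0" using hk k by (auto simp: hat_def hat_knots_def)
      then show ?thesis using 7 by (auto simp: diff2_def)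
    qed
  qed
  then show "diff2 ?h k \<le> of_bool (k = p) + of_bool (k = q)"
    and "- 2 * of_bool (k = t) \<le> diff2 ?h k" by auto
qed

lemma pl_zero:
  assumes "p < t" "t \<le> K" "real p \<le> z" "z \<le> real t" "\<And>k. p \<le> k \<Longrightarrow> k \<le> t \<Longrightarrow> b k = 0"
  shows "pl K b z = 0"
  using pl_affine[of p t K z b 0 0] assms by simp

lemma hat_pl_left:
  assumes "hat_knots K p t q" "p < t" "real p \<le> z" "z \<le> real t"
  shows "pl K (hat p t q) z = (z - real p) / (real t - real p)"
proof -
  have "pl K (hat p t q) z = - real p / (real t - real p) + 1 / (real t - real p) * z"
  proof (rule pl_affine[of p t])
    fix k assume "p \<le> k" "k \<le> t"
    then have "hat p t q k = (real k - real p) / (real t - real p)" using assms by (intro hat_left) auto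
    then show "hat p t q k = - real p / (real t - real p) + 1 / (real t - real p) * real k"
      by (simp add: diff_divide_distrib)
  qed (use assms in \<open>auto simp: hat_knots_def\<close>)
  then show ?thesis by (simp add: diff_divide_distrib)
qed

lemma hat_pl_right:
  assumes "hat_knots K p t q" "t < q" "real t \<le> z" "z \<le> real q"
  shows "pl K (hat p t q) z = (real q - z) / (real q - real t)"
proof -
  have "pl K (hat p t q) z = real q / (real q - real t) + (- 1 / (real q - real t)) * z"
  proof (rule pl_affine[of t q])
    fix k assume "t \<le> k" "k \<le> q"
    then have "hat p t q k = (real q - real k) / (real q - real t)" using assms by (intro hat_right) auto
    then show "hat p t q k = real q / (real q - real t) + (- 1 / (real q - real t)) * real k"
      by (simp add: diff_divide_distrib)
  qed (use assms in \<open>auto simp: hat_knots_def\<close>)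
  then show ?thesis by (simp add: diff_divide_distrib)
qed

text \<open>The last premise excludes the peak of a one-sided hat: for \<open>p = t = 0\<close> or
  \<open>t = q = K\<close> the point \<open>z = t\<close> is not strictly between the feet, yet the
  hat equals \<open>1\<close> there.\<close>

lemma hat_pl_outside:
  assumes hk: "hat_knots K p t q" and z: "0 \<le> z" "z \<le> real K" and out: "\<not> (real p < z \<and> z < real q)"
    and "z = real t \<longrightarrow> p < t \<and> t < q"
  shows "pl K (hat p t q) z = 0"
proof -
  consider "z \<le> real p" "p < t" | "z \<le> real p" "t = 0" "p = 0" | "real q \<le> z" "t < q" | "real q \<le> z" "t = K" "q = K"
    using out hk by (auto simp: hat_knots_def)
  then show ?thesis
  proof cases
    case 1
    show ?thesis
    proof (cases "p = 0")
      case True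
      then have "z = 0" using z 1 by auto
      then show ?thesis using pl_knot[of 0 K "hat p t q"] True 1 by (simp add: hat_def)
    next
      case False
      show ?thesis by (rule pl_zero[of 0 p])
        (use False z 1 hk in \<open>auto simp: hat_def hat_knots_def\<close>)
    qed
  next
    case 2
    then show ?thesis using assms by auto
  next
    case 3
    show ?thesis
    proof (cases "q = K")
      case True
      then have "z = real K" using z 3 by auto
      then show ?thesis using pl_knot[of K K "hat p t q"] True 3 by (simp add: hat_def)
    next
      case False
      show ?thesis by (rule pl_zero[of q K])
        (use False z 3 hk in \<open>auto simp: hat_def hat_knots_def\<close>)
    qed
  next
    case 4
    then show ?thesis using assms by auto
  qed
qed

section \<open>Sums of hat functions over the design points\<close>

text \<open>On a flank that covers \<open>d\<close> cells the sampled values are the fractions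
  \<open>s / (d m)\<close>; the right flank is read backwards from its foot. \<open>F 0 = 0\<close>
  removes the points outside. The peak is sampled except at \<open>t = 0\<close>, because the design
  starts at \<open>1 / n\<close> and not at \<open>0\<close>.\<close>

lemma hat_sum:
  fixes F :: "real \<Rightarrow> real"
  assumes hk: "hat_knots K p t q" and m: "m > 0" and F0: "F 0 = 0"
  shows "(\<Sum>i=1..K*m. F (pl K (hat p t q) (real i / real m)))
     = (\<Sum>s\<in>{1..<(t-p)*m}. F (real s / real ((t-p)*m))) + (if t = 0 then 0 else F 1)
       + (\<Sum>s\<in>{1..<(q-t)*m}. F (real s / real ((q-t)*m)))"
proof -
  let ?f = "\<lambda>i. F (pl K (hat p t q) (real i / real m))"
  have tq: "t \<le> q" "q \<le> K" "p \<le> t" using hk by (auto simp: hat_knots_def)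
  have tK: "t * m \<le> K * m" using tq by auto
  have left: "sum ?f {1..<t*m} = (\<Sum>s\<in>{1..<(t-p)*m}. F (real s / real ((t-p)*m)))"
  proof (cases "t = 0")
    case False
    then have pt: "p < t" using hk by (auto simp: hat_knots_def)
    have "sum ?f {1..<t*m} = sum ?f {p*m+1..<t*m}"
    proof (rule sum.mono_neutral_right)
      show "\<forall>i\<in>{1..<t*m} - {p*m+1..<t*m}. ?f i = 0"
      proof
        fix i assume i: "i \<in> {1..<t*m} - {p*m+1..<t*m}"
        then have "i \<le> p * m" by auto
        then have "real i \<le> real p * real m" by (metis of_nat_le_iff of_nat_mult)
        then have ip: "real i / real m \<le> real p" using m by (simp add: divide_simps)
        have "pl K (hat p t q) (real i / real m) = 0"
          by (rule hat_pl_outside[OF hk]) (use ip tq pt in \<open>auto\<close>)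
        then show "?f i = 0" using F0 by simp
      qed
    qed auto
    also have "\<dots> = (\<Sum>s\<in>{1..<(t-p)*m}. ?f (s + p*m))"
      using pt by (subst sum.shift_bounds_nat_ivl[symmetric]) (auto simp: diff_mult_distrib)
    also have "\<dots> = (\<Sum>s\<in>{1..<(t-p)*m}. F (real s / real ((t-p)*m)))"
    proof (rule sum.cong[OF refl])
      fix s assume s: "s \<in> {1..<(t-p)*m}"
      then have "real s < real ((t-p)*m)" by (simp only: of_nat_less_iff) auto
      then have "real s < (real t - real p) * real m" using pt by (simp add: of_nat_diff)
      then have sl: "real s / real m < real t - real p" using m by (simp add: divide_simps)
      have e: "real (s + p*m) / real m = real p + real s / real m" using m by (simp add: add_divide_distrib)
      have "pl K (hat p t q) (real (s + p*m) / real m) = (real p + real s / real m - real p) / (real t - real p)"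
        unfolding e by (rule hat_pl_left[OF hk pt]) (use sl in auto)
      also have "\<dots> = real s / real ((t-p)*m)" using pt by (simp add: of_nat_diff)
      finally show "?f (s + p*m) = F (real s / real ((t-p)*m))" by simp
    qed
    finally show ?thesis .
  qed simp
  have right: "sum ?f {t*m<..K*m} = (\<Sum>s\<in>{1..<(q-t)*m}. F (real s / real ((q-t)*m)))"
  proof (cases "t = K")
    case False
    then have qt: "t < q" using hk by (auto simp: hat_knots_def)
    have qK: "q * m \<le> K * m" using tq by auto
    have "sum ?f {t*m<..K*m} = sum ?f {t*m<..<q*m}"
    proof (rule sum.mono_neutral_right)
      show "\<forall>i\<in>{t*m<..K*m} - {t*m<..<q*m}. ?f i = 0"
      proof
        fix i assume i: "i \<in> {t*m<..K*m} - {t*m<..<q*m}"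
        then have "q * m \<le> i" "i \<le> K * m" by auto
        then have "real q * real m \<le> real i" "real i \<le> real K * real m" by (metis of_nat_le_iff of_nat_mult)+
        then have ip: "real q \<le> real i / real m" "real i / real m \<le> real K" using m by (simp_all add: divide_simps)
        have "pl K (hat p t q) (real i / real m) = 0"
          by (rule hat_pl_outside[OF hk]) (use ip tq qt in \<open>auto\<close>)
        then show "?f i = 0" using F0 by simp
      qed
      show "{t*m<..<q*m} \<subseteq> {t*m<..K*m}"
      proof
        fix i assume "i \<in> {t*m<..<q*m}"
        then have "t * m < i" "i < q * m" by auto
        with qK have "t * m < i" "i \<le> K * m" by linarith+
        then show "i \<in> {t*m<..K*m}" by (simp only: greaterThanAtMost_iff)
      qed
    qed auto
    also have "\<dots> = (\<Sum>s\<in>{1..<(q-t)*m}. ?f (q*m - s))"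
    proof (rule sum.reindex_bij_witness[of _ "\<lambda>s. q*m - s" "\<lambda>i. q*m - i"])
      have *: "(q-t)*m = q*m - t*m" "t*m < q*m" using qt m by (auto simp: diff_mult_distrib)
      fix b assume "b \<in> {1..<(q-t)*m}"
      then show "q * m - b \<in> {t * m<..<q * m}" using * by auto
    qed (auto simp: diff_mult_distrib)
    also have "\<dots> = (\<Sum>s\<in>{1..<(q-t)*m}. F (real s / real ((q-t)*m)))"
    proof (rule sum.cong[OF refl])
      fix s assume s: "s \<in> {1..<(q-t)*m}"
      then have "real s < real ((q-t)*m)" by (simp only: of_nat_less_iff) auto
      then have "real s < (real q - real t) * real m" using qt by (simp add: of_nat_diff)
      then have sl: "real s / real m < real q - real t" using m by (simp add: divide_simps)
      have "s \<le> q * m" using s by (auto simp: diff_mult_distrib)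
      then have e: "real (q*m - s) / real m = real q - real s / real m"
        using m by (simp add: of_nat_diff diff_divide_distrib)
      have "pl K (hat p t q) (real (q*m - s) / real m) = (real q - (real q - real s / real m)) / (real q - real t)"
        unfolding e by (rule hat_pl_right[OF hk qt]) (use sl in auto)
      also have "\<dots> = real s / real ((q-t)*m)" using qt by (simp add: of_nat_diff)
      finally show "?f (q*m - s) = F (real s / real ((q-t)*m))" by simp
    qed
    finally show ?thesis .
  next
    case True
    then have "q = t" using tq by auto
    then show ?thesis using True by simp
  qed
  have mid: "?f (t * m) = F 1"
    using pl_knot[of t K "hat p t q"] tq m by (simp add: hat_def)
  show ?thesis
  proof (cases "t = 0")
    case True
    have "{1..K*m} = {t*m<..K*m}" using True by auto
    then show ?thesis using right left True by simp
  next
    case False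
    then have "1 \<le> t * m" using m by auto
    moreover have "{1..n} = insert j ({1..<j} \<union> {j<..n})" if "1 \<le> j" "j \<le> n" for j n :: nat
      using that by auto
    ultimately have "{1..K*m} = insert (t*m) ({1..<t*m} \<union> {t*m<..K*m})" using tK by blast
    moreover have "sum ?f (insert (t*m) ({1..<t*m} \<union> {t*m<..K*m}))
       = ?f (t*m) + (sum ?f {1..<t*m} + sum ?f {t*m<..K*m})"
      by (subst sum.insert) (auto intro!: sum.union_disjoint)
    ultimately show ?thesis using left right mid False by simp
  qed
qed

lemma ramp_sum: "L > 0 \<Longrightarrow> (\<Sum>s\<in>{1..<L}. real s / real L) = (real L - 1) / 2"
proof -
  assume L: "L > 0"
  have "(\<Sum>s\<in>{1..<L}. real s) = real L * (real L - 1) / 2" using L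
    by (induction L rule: nat_induct_non_zero) (auto simp: field_simps)
  then show ?thesis using L by (simp add: sum_divide_distrib[symmetric])
qed

lemma ramp_sum_square:
  "L > 0 \<Longrightarrow> (\<Sum>s\<in>{1..<L}. (real s / real L)\<^sup>2) = (real L - 1) * (2 * real L - 1) / (6 * real L)"
proof -
  assume L: "L > 0"
  have eq: "(\<Sum>s\<in>{1..<L}. (real s)\<^sup>2) = real L * (real L - 1) * (2 * real L - 1) / 6" using L
    by (induction L rule: nat_induct_non_zero) (auto simp: field_simps power2_eq_square)
  have "(\<Sum>s\<in>{1..<L}. (real s / real L)\<^sup>2) = (\<Sum>s\<in>{1..<L}. (real s)\<^sup>2) / (real L)\<^sup>2"
    by (simp add: power_divide sum_divide_distrib)
  also have "\<dots> = real L * (real L - 1) * (2 * real L - 1) / 6 / (real L)\<^sup>2"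
    by (simp only: eq)
  also have "\<dots> = (real L - 1) * (2 * real L - 1) / (6 * real L)"
    using L by (simp add: power2_eq_square divide_simps)
  finally show ?thesis .
qed

text \<open>
  The sum equals \<open>(L - 1) (L - 5) / (6 L)\<close>. Any constant above \<open>1/2\<close> in place of \<open>3/5\<close> would do.
\<close>

lemma ramp_ineq:
  assumes "L = 0 \<or> L \<ge> 5"
  shows "0 \<le> (\<Sum>s\<in>{1..<L}. real s / real L * (5 * (real s / real L) - 3))"
proof (cases "L = 0")
  case False
  then have L: "L \<ge> 5" using assms by auto
  have "(\<Sum>s\<in>{1..<L}. real s / real L * (5 * (real s / real L) - 3))
      = (\<Sum>s\<in>{1..<L}. 5 * (real s / real L)\<^sup>2 - 3 * (real s / real L))"
    by (intro sum.cong refl) (simp add: algebra_simps power2_eq_square)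
  also have "\<dots> = 5 * ((real L - 1) * (2 * real L - 1) / (6 * real L)) - 3 * ((real L - 1) / 2)"
    using L by (simp only: sum_subtractf sum_distrib_left[symmetric] ramp_sum ramp_sum_square)
  also have "\<dots> = (real L - 1) * (real L - 5) / (6 * real L)" using L by (simp add: field_simps)
  also have "\<dots> \<ge> 0" using L by simp
  finally show ?thesis .
qed simp

text \<open>\<open>hat_sum\<close> is applied to \<open>x (5 x - 3)\<close>. Each flank has length
  \<open>0\<close> or at least \<open>m \<ge> 5\<close>, so \<open>ramp_ineq\<close> makes it
  nonnegative, and a sampled peak contributes \<open>2\<close>.\<close>

lemma hat_square_sum:
  assumes hk: "hat_knots K p t q" and m: "m \<ge> 5"
  shows "3 * (\<Sum>i=1..K*m. pl K (hat p t q) (real i / real m))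
       \<le> 5 * (\<Sum>i=1..K*m. (pl K (hat p t q) (real i / real m))\<^sup>2)"
proof -
  let ?F = "\<lambda>x::real. x * (5 * x - 3)"
  have "d * m = 0 \<or> d * m \<ge> 5" for d
    using m by (cases d) auto
  note r = ramp_ineq[OF this]
  have "0 \<le> (\<Sum>i=1..K*m. ?F (pl K (hat p t q) (real i / real m)))"
    using m r[of "t-p"] r[of "q-t"]
    by (subst hat_sum[OF hk]) (simp_all del: of_nat_mult)
  also have "\<dots> = (\<Sum>i=1..K*m. 5 * (pl K (hat p t q) (real i / real m))\<^sup>2 - 3 * pl K (hat p t q) (real i / real m))"
    by (intro sum.cong refl) (simp add: algebra_simps power2_eq_square)
  finally show ?thesis by (simp add: sum_subtractf sum_distrib_left)
qed

section \<open>Unit hats on the design points\<close>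

text \<open>For \<open>n = K m\<close> this is the B-spline number \<open>k + 1\<close> at the
  \<open>i\<close>-th design point, see \<open>bspline_design\<close>.\<close>

definition tent :: "nat \<Rightarrow> nat \<Rightarrow> nat \<Rightarrow> real" where
  "tent m k i = max 0 (1 - \<bar>real i / real m - real k\<bar>)"

lemma pl_tent: "pl K b (real i / real m) = (\<Sum>k\<le>K. b k * tent m k i)"
  by (simp add: pl_def tent_def)

lemma hat_knots_unit: "K > 0 \<Longrightarrow> k \<le> K \<Longrightarrow> hat_knots K (k - 1) k (min (k + 1) K)"
  by (auto simp: hat_knots_def)

lemma hat_unit: "j \<le> K \<Longrightarrow> k \<le> K \<Longrightarrow> hat (k - 1) k (min (k + 1) K) j = of_bool (j = k)"
  by (auto simp: hat_def)

lemma pl_hat_unit: "k \<le> K \<Longrightarrow> pl K (hat (k - 1) k (min (k + 1) K)) (real i / real m) = tent m k i"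
proof -
  assume k: "k \<le> K"
  have "pl K (hat (k - 1) k (min (k + 1) K)) (real i / real m) = (\<Sum>j\<le>K. if j = k then tent m k i else 0)"
    unfolding pl_tent by (intro sum.cong refl) (use k hat_unit in \<open>auto\<close>)
  then show ?thesis using k by simp
qed

lemma tent_sum:
  assumes "K > 0" "k \<le> K" "m > 0"
  shows "(\<Sum>i=1..K*m. tent m k i)
    = of_bool (k > 0) * ((real m - 1) / 2) + of_bool (k > 0) + of_bool (k < K) * ((real m - 1) / 2)"
proof -
  have r: "(\<Sum>s\<in>{1..<d*m}. real s / real (d*m)) = of_bool (d > 0) * ((real m - 1) / 2)" if "d \<le> 1" for d
  proof (cases "d = 0")
    case False
    then have "d = 1" using that by auto
    then show ?thesis using ramp_sum[of m] assms by simp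
  qed simp
  have 1: "k - (k-1) \<le> 1" "min (k+1) K - k \<le> 1" "(k - (k-1) > 0) = (k > 0)" "(min (k+1) K - k > 0) = (k < K)"
    using assms by auto
  have "(\<Sum>i=1..K*m. tent m k i) = (\<Sum>i=1..K*m. pl K (hat (k - 1) k (min (k + 1) K)) (real i / real m))"
    using pl_hat_unit[of k K] assms(2) by simp
  also have "\<dots> = of_bool (k > 0) * ((real m - 1) / 2) + of_bool (k > 0) + of_bool (k < K) * ((real m - 1) / 2)"
    unfolding hat_sum[OF hat_knots_unit[OF assms(1,2)] assms(3), of "\<lambda>x. x", OF refl]
      r[OF 1(1), unfolded 1(3)] r[OF 1(2), unfolded 1(4)] by auto
  finally show ?thesis .
qed

lemma tent_sum_le: "K > 0 \<Longrightarrow> k \<le> K \<Longrightarrow> m > 0 \<Longrightarrow> (\<Sum>i=1..K*m. tent m k i) \<le> real m"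
  using tent_sum[of K k m] by (cases "k = 0"; cases "k = K") (auto simp: field_simps)

text \<open>The smallest mass is \<open>(m - 1) / 2\<close>, attained at \<open>k = 0\<close>, where
  the peak is not a design point. It is at least \<open>2 / 5 * m\<close> exactly when
  \<open>m \<ge> 5\<close>.\<close>

lemma tent_sum_ge: "K > 0 \<Longrightarrow> k \<le> K \<Longrightarrow> m \<ge> 5 \<Longrightarrow> 2 / 5 * real m \<le> (\<Sum>i=1..K*m. tent m k i)"
  using tent_sum[of K k m] by (cases "k = 0"; cases "k = K") (auto simp: field_simps)

lemma tent_bounds: "0 \<le> tent m k i" "tent m k i \<le> 1"
  by (auto simp: tent_def)

lemma tent_square_sum_le: "K > 0 \<Longrightarrow> k \<le> K \<Longrightarrow> m > 0 \<Longrightarrow> (\<Sum>i=1..K*m. (tent m k i)\<^sup>2) \<le> real m"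
proof -
  assume a: "K > 0" "k \<le> K" "m > 0"
  have "(\<Sum>i=1..K*m. (tent m k i)\<^sup>2) \<le> (\<Sum>i=1..K*m. tent m k i)"
    using tent_bounds[of m k] by (intro sum_mono) (simp add: power2_eq_square mult_left_le)
  then show ?thesis using tent_sum_le[OF a] by simp
qed

section \<open>Uniform stability of the constrained minimum\<close>

text \<open>The bilinear form of penalized least squares before division by \<open>beta\<close>;
  accordingly \<open>lam\<close> is the original penalty parameter and not its quotient by
  \<open>beta\<close>.\<close>

definition qform :: "nat \<Rightarrow> nat \<Rightarrow> real \<Rightarrow> (nat \<Rightarrow> real) \<Rightarrow> (nat \<Rightarrow> real) \<Rightarrow> real" where
  "qform K m lam b c = (\<Sum>i=1..K*m. pl K b (real i / real m) * pl K c (real i / real m))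
     + lam * (\<Sum>k\<in>{1..<K}. diff2 b k * diff2 c k)"

definition lform :: "nat \<Rightarrow> nat \<Rightarrow> (nat \<Rightarrow> real) \<Rightarrow> (nat \<Rightarrow> real) \<Rightarrow> real" where
  "lform K m y b = (\<Sum>i=1..K*m. pl K b (real i / real m) * y i)"

definition convex_seq :: "nat \<Rightarrow> (nat \<Rightarrow> real) \<Rightarrow> bool" where
  "convex_seq K b \<longleftrightarrow> (\<forall>k\<in>{1..<K}. 0 \<le> diff2 b k)"

text \<open>The directions \<open>v\<close> are those that keep \<open>b + s v\<close> convex for all small \<open>s > 0\<close>.\<close>

definition stationary :: "nat \<Rightarrow> nat \<Rightarrow> real \<Rightarrow> (nat \<Rightarrow> real) \<Rightarrow> (nat \<Rightarrow> real) \<Rightarrow> bool" where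
  "stationary K m lam y b \<longleftrightarrow> convex_seq K b \<and>
     (\<forall>v. (\<forall>k\<in>{1..<K}. diff2 b k = 0 \<longrightarrow> 0 \<le> diff2 v k) \<longrightarrow> lform K m y v \<le> qform K m lam b v)"

text \<open>Strictness to the left makes the second difference at an interior \<open>j\<close>
  strictly positive. This yields the minimum principle \<open>concave_seq_nonneg\<close>, and in
  \<open>lower_deviation\<close> it makes \<open>b\<close> curve strictly more than the convex
  \<open>a\<close>, so that \<open>b\<close> has a kink.\<close>

lemma first_argmin:
  fixes w :: "nat \<Rightarrow> real"
  assumes "p \<le> t"
  obtains j where "p \<le> j" "j \<le> t" "\<And>k. p \<le> k \<Longrightarrow> k \<le> t \<Longrightarrow> w j \<le> w k" "\<And>k. p \<le> k \<Longrightarrow> k < j \<Longrightarrow> w j < w k"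
proof -
  define \<mu> where "\<mu> = Min (w ` {p..t})"
  let ?P = "\<lambda>j. j \<in> {p..t} \<and> w j = \<mu>"
  have ne: "w ` {p..t} \<noteq> {}" using assms by auto
  have "\<mu> \<in> w ` {p..t}" unfolding \<mu>_def by (rule Min_in) (use ne in auto)
  then have ex: "\<exists>j. ?P j" by auto
  define j where "j = (LEAST j. ?P j)"
  have j: "?P j" unfolding j_def using ex by (rule LeastI_ex)
  have mn: "\<mu> \<le> w k" if "k \<in> {p..t}" for k
    unfolding \<mu>_def by (rule Min_le) (use that in auto)
  have "w j < w k" if "p \<le> k" "k < j" for k
  proof -
    have "k \<in> {p..t}" using that j by auto
    moreover have "\<not> ?P k" using not_less_Least[of k ?P] that j_def by auto
    ultimately show ?thesis using mn[of k] j by auto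
  qed
  then show ?thesis using that[of j] j mn by auto
qed

lemma concave_seq_nonneg:
  assumes conc: "\<And>k. p < k \<Longrightarrow> k < t \<Longrightarrow> diff2 w k \<le> 0"
    and "0 \<le> w p" "0 \<le> w t" and k: "p \<le> k" "k \<le> t"
  shows "0 \<le> w k"
proof -
  have "p \<le> t" using k by simp
  then obtain j where j: "p \<le> j" "j \<le> t" "\<And>k. p \<le> k \<Longrightarrow> k \<le> t \<Longrightarrow> w j \<le> w k"
    "\<And>k. p \<le> k \<Longrightarrow> k < j \<Longrightarrow> w j < w k"
    using first_argmin[of p t w] by metis
  have "j = p \<or> j = t"
  proof (rule ccontr)
    assume "\<not> ?thesis"
    then have jj: "p < j" "j < t" using j by auto
    then have "w j < w (j - 1)" "w j \<le> w (j + 1)" using j(3)[of "j+1"] j(4)[of "j-1"] by auto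
    moreover have "diff2 w j \<le> 0" using conc jj by auto
    ultimately show False by (simp add: diff2_def)
  qed
  then show ?thesis using assms(2,3) j(3)[OF k] by auto
qed

text \<open>Where no kink is left, the end knot takes its place: no constraint acts there, so it
  serves as a foot just as well.\<close>

lemma prev_kink:
  fixes t :: nat
  obtains p where "p < t \<or> p = 0 \<and> t = 0" "p = 0 \<or> P p" "\<And>k. p < k \<Longrightarrow> k < t \<Longrightarrow> \<not> P k"
proof (cases "t = 0")
  case True then show ?thesis using that[of 0] by auto
next
  case False
  let ?A = "insert 0 {k. k < t \<and> P k}"
  have f: "finite ?A" by auto
  have "Max ?A \<in> ?A" by (rule Max_in) (use f in auto)
  moreover have "k \<le> Max ?A" if "k < t" "P k" for k by (rule Max_ge) (use f that in auto)
  ultimately obtain x where "x \<in> ?A" "\<And>k. k < t \<Longrightarrow> P k \<Longrightarrow> k \<le> x" by blast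
  then show ?thesis using that[of x] False by (metis insertE leD mem_Collect_eq neq0_conv)
qed

lemma next_kink:
  fixes t :: nat
  assumes "t \<le> K"
  obtains q where "t < q \<or> t = K \<and> q = K" "q \<le> K" "q = K \<or> P q" "\<And>k. t < k \<Longrightarrow> k < q \<Longrightarrow> \<not> P k"
proof (cases "t = K")
  case True then show ?thesis using that[of K] by auto
next
  case False
  let ?A = "insert K {k. t < k \<and> k < K \<and> P k}"
  have f: "finite ?A" by auto
  have "Min ?A \<in> ?A" by (rule Min_in) (use f in auto)
  moreover have "Min ?A \<le> k" if "t < k" "k < K" "P k" for k by (rule Min_le) (use f that in auto)
  moreover have "Min ?A \<le> K" by (rule Min_le) (use f in auto)
  ultimately obtain x where "x \<in> ?A" "\<And>k. t < k \<Longrightarrow> k < K \<Longrightarrow> P k \<Longrightarrow> x \<le> k" "x \<le> K" by blast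
  then show ?thesis using that[of x] False assms
    by (metis insertE leD le_neq_implies_less mem_Collect_eq order_less_le_trans)
qed

lemma hat_pl_nonneg:
  assumes "0 < K" "0 \<le> z" "z \<le> real K"
  shows "0 \<le> pl K (hat p t q) z"
  unfolding pl_def by (intro sum_nonneg mult_nonneg_nonneg hat_nonneg) auto

text \<open>The sign of \<open>w\<close> is known only between the feet in
  \<open>upper_deviation\<close>; outside them the hat vanishes.\<close>

lemma hat_mult_nonneg:
  assumes hk: "hat_knots K p t q" and K: "0 < K" and z: "0 \<le> z" "z \<le> real K"
    and w: "\<And>k. p \<le> k \<Longrightarrow> k \<le> q \<Longrightarrow> 0 \<le> w k"
  shows "0 \<le> pl K (hat p t q) z * pl K w z"
proof -
  have tq: "p \<le> t" "t \<le> q" "q \<le> K" using hk by (auto simp: hat_knots_def)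
  have z0: "pl K (\<lambda>_. 0) z = 0" by (simp add: pl_def)
  consider "p < t" "real p \<le> z" "z \<le> real t" | "t < q" "real t \<le> z" "z \<le> real q"
    | "\<not> (real p < z \<and> z < real q)" "z = real t \<longrightarrow> p < t \<and> t < q"
    using hk K by (fastforce simp: hat_knots_def)
  then show ?thesis
  proof cases
    case 1
    have "pl K (\<lambda>_. 0) z \<le> pl K w z"
      by (rule pl_mono[of p t]) (use 1 tq w in auto)
    then show ?thesis using z0 hat_pl_nonneg[OF K z] by simp
  next
    case 2
    have "pl K (\<lambda>_. 0) z \<le> pl K w z"
      by (rule pl_mono[of t q]) (use 2 tq w in auto)
    then show ?thesis using z0 hat_pl_nonneg[OF K z] by simp
  next
    case 3
    then show ?thesis using hat_pl_outside[OF hk z] by simp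
  qed
qed

lemma design_range: "i \<in> {1..K*m} \<Longrightarrow> 0 < m \<Longrightarrow> 0 \<le> real i / real m \<and> real i / real m \<le> real K"
proof -
  assume "i \<in> {1..K*m}" "0 < m"
  then have "real i \<le> real K * real m" by (metis atLeastAtMost_iff of_nat_le_iff of_nat_mult)
  then show ?thesis using \<open>0 < m\<close> by (simp add: divide_simps)
qed

lemma pl_sum_swap:
  "(\<Sum>i=1..K*m. pl K b (real i / real m) * e i) = (\<Sum>k\<le>K. b k * (\<Sum>i=1..K*m. tent m k i * e i))"
  unfolding pl_tent sum_distrib_right sum_distrib_left
  by (subst sum.swap) (simp add: mult.assoc)

lemma hat_sum_ge:
  assumes "hat_knots K p t q" "0 < K" "5 \<le> m"
  shows "2 / 5 * real m * (\<Sum>k\<le>K. hat p t q k) \<le> (\<Sum>i=1..K*m. pl K (hat p t q) (real i / real m))"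
proof -
  have "2 / 5 * real m * (\<Sum>k\<le>K. hat p t q k) = (\<Sum>k\<le>K. hat p t q k * (2 / 5 * real m))"
    by (simp only: sum_distrib_right[symmetric] mult.commute)
  also have "\<dots> \<le> (\<Sum>k\<le>K. hat p t q k * (\<Sum>i=1..K*m. tent m k i * 1))"
    using assms tent_sum_ge[of K _ m] by (intro sum_mono mult_left_mono hat_nonneg) auto
  also have "\<dots> = (\<Sum>i=1..K*m. pl K (hat p t q) (real i / real m))"
    using pl_sum_swap[of K "hat p t q" m "\<lambda>_. 1"] by simp
  finally show ?thesis .
qed

lemma hat_mass_ge1: "t \<le> K \<Longrightarrow> 1 \<le> (\<Sum>k\<le>K. hat p t q k)"
proof -
  assume "t \<le> K"
  then have "hat p t q t \<le> (\<Sum>k\<le>K. hat p t q k)"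
    by (intro member_le_sum) (auto simp: hat_nonneg)
  then show ?thesis by (simp add: hat_def)
qed

text \<open>The noise sums of the unit hats are weighted by the knot values of the hat, so they are
  at most \<open>Z\<close> times the sum of these values. By \<open>hat_sum_ge\<close> that sum is
  at most \<open>5 / (2 m)\<close> times the mass. No property of \<open>p\<close>,
  \<open>t\<close>, \<open>q\<close> enters the constant, so the hat may be chosen after the noise
  is known.\<close>

lemma hat_noise:
  assumes hk: "hat_knots K p t q" and K: "0 < K" "5 \<le> m"
    and Z: "\<And>k. k \<le> K \<Longrightarrow> \<bar>\<Sum>i=1..K*m. tent m k i * e i\<bar> \<le> Z"
  shows "\<bar>\<Sum>i=1..K*m. pl K (hat p t q) (real i / real m) * e i\<bar>
     \<le> 5 / 2 * Z / real m * (\<Sum>i=1..K*m. pl K (hat p t q) (real i / real m))"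
proof -
  have Z0: "0 \<le> Z" using Z[of 0] by linarith
  have "\<bar>\<Sum>i=1..K*m. pl K (hat p t q) (real i / real m) * e i\<bar>
      \<le> (\<Sum>k\<le>K. \<bar>hat p t q k * (\<Sum>i=1..K*m. tent m k i * e i)\<bar>)"
    unfolding pl_sum_swap by (rule sum_abs)
  also have "\<dots> \<le> (\<Sum>k\<le>K. hat p t q k * Z)"
    unfolding abs_mult using Z by (intro sum_mono mult_mono) (auto simp: hat_nonneg)
  also have "\<dots> = 5 / 2 * Z / real m * (2 / 5 * real m * (\<Sum>k\<le>K. hat p t q k))"
    using K by (simp add: sum_distrib_right[symmetric])
  also have "\<dots> \<le> 5 / 2 * Z / real m * (\<Sum>i=1..K*m. pl K (hat p t q) (real i / real m))"
    using Z0 by (intro mult_left_mono hat_sum_ge[OF hk K]) auto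
  finally show ?thesis .
qed

lemma hat_bias:
  assumes K: "0 < K" "0 < m" and G: "\<And>i. i \<in> {1..K*m} \<Longrightarrow> \<bar>g i\<bar> \<le> G"
  shows "\<bar>\<Sum>i=1..K*m. pl K (hat p t q) (real i / real m) * g i\<bar>
     \<le> G * (\<Sum>i=1..K*m. pl K (hat p t q) (real i / real m))"
proof -
  have "\<bar>\<Sum>i=1..K*m. pl K (hat p t q) (real i / real m) * g i\<bar>
     \<le> (\<Sum>i=1..K*m. \<bar>pl K (hat p t q) (real i / real m) * g i\<bar>)" by (rule sum_abs)
  also have "\<dots> \<le> (\<Sum>i=1..K*m. pl K (hat p t q) (real i / real m) * G)"
    unfolding abs_mult
  proof (rule sum_mono)
    fix i assume i: "i \<in> {1..K*m}"
    have "0 \<le> pl K (hat p t q) (real i / real m)"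
      using hat_pl_nonneg[OF K(1)] design_range[OF i K(2)] by auto
    then show "\<bar>pl K (hat p t q) (real i / real m)\<bar> * \<bar>g i\<bar> \<le> pl K (hat p t q) (real i / real m) * G"
      using G[OF i] by (auto intro: mult_left_mono)
  qed
  also have "\<dots> = G * (\<Sum>i=1..K*m. pl K (hat p t q) (real i / real m))"
    by (subst mult.commute) (rule sum_distrib_right[symmetric])
  finally show ?thesis .
qed

lemma diff2_diff: "diff2 (\<lambda>k. b k - c k) k = diff2 b k - diff2 c k"
  by (simp add: diff2_def)

lemma diff2_uminus: "diff2 (\<lambda>k. - b k) k = - diff2 b k"
  by (simp add: diff2_def)

text \<open>Here \<open>a\<close> is the target, \<open>g\<close> the approximation error at the
  design points and \<open>e\<close> the noise. \<open>M\<close> and \<open>R\<close> are bounds;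
  each of the two deviation lemmas assumes that its own one is attained. \<open>err\<close> collects
  bias, noise and penalty per unit of hat mass.\<close>

context
  fixes K m :: nat and lam C G Z M R err :: real and y a b g e :: "nat \<Rightarrow> real"
  assumes K: "100 \<le> K" and m: "5 \<le> m" and lam: "0 \<le> lam" "lam \<le> real m / real K"
    and st: "stationary K m lam y b"
    and a: "\<And>k. k \<in> {1..<K} \<Longrightarrow> 0 \<le> diff2 a k \<and> diff2 a k \<le> C" and C: "0 \<le> C"
    and y: "\<And>i. i \<in> {1..K*m} \<Longrightarrow> y i = pl K a (real i / real m) + g i + e i"
    and g: "\<And>i. i \<in> {1..K*m} \<Longrightarrow> \<bar>g i\<bar> \<le> G"
    and e: "\<And>k. k \<le> K \<Longrightarrow> \<bar>\<Sum>i=1..K*m. tent m k i * e i\<bar> \<le> Z"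
    and MR: "\<And>k. k \<le> K \<Longrightarrow> - R \<le> b k - a k \<and> b k - a k \<le> M"
    and err: "err = G + 5 / 2 * Z / real m + 5 * C / real K"
begin

lemma b_convex: "k \<in> {1..<K} \<Longrightarrow> 0 \<le> diff2 b k"
  using st by (auto simp: stationary_def convex_seq_def)

lemma lform_y:
  "lform K m y h = (\<Sum>i=1..K*m. pl K h (real i / real m) * pl K a (real i / real m))
     + (\<Sum>i=1..K*m. pl K h (real i / real m) * g i) + (\<Sum>i=1..K*m. pl K h (real i / real m) * e i)"
  unfolding lform_def sum.distrib[symmetric] by (intro sum.cong refl) (simp add: y algebra_simps)

lemma qform_b:
  "qform K m lam b h = (\<Sum>i=1..K*m. pl K h (real i / real m) * pl K a (real i / real m))
     + (\<Sum>i=1..K*m. pl K h (real i / real m) * pl K (\<lambda>k. b k - a k) (real i / real m))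
     + lam * (\<Sum>k\<in>{1..<K}. diff2 b k * diff2 h k)"
  unfolding qform_def sum.distrib[symmetric] pl_diff by (simp add: algebra_simps)

lemma MR_nonneg: "0 \<le> M + R" using MR[of 0] by simp

text \<open>Every hat has mass at least \<open>2 / 5 * m\<close>, as its peak value alone counts for
  a unit hat, and \<open>lam\<close> is at most \<open>m / K\<close>. The factor \<open>2\<close> is
  the size of the second difference at the peak in one application, and the number of feet in the
  other.\<close>

lemma lam_bound:
  assumes "hat_knots K p t q" "0 \<le> B"
  shows "lam * (2 * B) \<le> 5 * B / real K * (\<Sum>i=1..K*m. pl K (hat p t q) (real i / real m))"
proof -
  have "t \<le> K" using assms by (auto simp: hat_knots_def)
  then have "2 / 5 * real m * 1 \<le> 2 / 5 * real m * (\<Sum>k\<le>K. hat p t q k)"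
    by (intro mult_left_mono hat_mass_ge1) auto
  also have "\<dots> \<le> (\<Sum>i=1..K*m. pl K (hat p t q) (real i / real m))"
    by (rule hat_sum_ge) (use assms K m in auto)
  finally have S: "2 / 5 * real m \<le> (\<Sum>i=1..K*m. pl K (hat p t q) (real i / real m))" by simp
  have "lam * (2 * B) \<le> real m / real K * (2 * B)" using lam assms by (intro mult_right_mono) auto
  also have "\<dots> = 5 * B / real K * (2 / 5 * real m)" by simp
  also have "\<dots> \<le> 5 * B / real K * (\<Sum>i=1..K*m. pl K (hat p t q) (real i / real m))"
    using S assms by (intro mult_left_mono) auto
  finally show ?thesis .
qed

lemma hat_total_pos:
  assumes "hat_knots K p t q"
  shows "0 < (\<Sum>i=1..K*m. pl K (hat p t q) (real i / real m))"
proof -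
  have "t \<le> K" using assms by (auto simp: hat_knots_def)
  then have "0 < 2 / 5 * real m * (\<Sum>k\<le>K. hat p t q k)" using m hat_mass_ge1[of t K p q] by simp
  also have "\<dots> \<le> (\<Sum>i=1..K*m. pl K (hat p t q) (real i / real m))"
    by (rule hat_sum_ge) (use assms K m in auto)
  finally show ?thesis .
qed

lemma upper_deviation:
  assumes t: "t \<le> K" "b t - a t = M"
  shows "3 / 5 * M - 2 / 5 * R \<le> err"
proof -
  have K0: "0 < K" and m0: "0 < m" using K m by auto
  define u where "u = (\<lambda>k. b k - a k)"
  obtain p where p: "p < t \<or> p = 0 \<and> t = 0" "p = 0 \<or> 0 < diff2 b p" "\<And>k. p < k \<Longrightarrow> k < t \<Longrightarrow> \<not> 0 < diff2 b k"
    using prev_kink[of t "\<lambda>k. 0 < diff2 b k"] by metis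
  obtain q where q: "t < q \<or> t = K \<and> q = K" "q \<le> K" "q = K \<or> 0 < diff2 b q" "\<And>k. t < k \<Longrightarrow> k < q \<Longrightarrow> \<not> 0 < diff2 b k"
    using next_kink[OF t(1), of "\<lambda>k. 0 < diff2 b k"] by metis
  have hk: "hat_knots K p t q" using p q by (auto simp: hat_knots_def)
  define h where "h = hat p t q"
  define S where "S = (\<Sum>i=1..K*m. pl K h (real i / real m))"
  have S0: "0 < S" unfolding S_def h_def by (rule hat_total_pos[OF hk])
  note h2 = hat_diff2[OF hk, folded h_def]
  \<comment> \<open>The gap between \<open>u\<close> and the function that interpolates
    \<open>-R\<close>, \<open>M\<close>, \<open>-R\<close> at \<open>p\<close>, \<open>t\<close>,
    \<open>q\<close>. On either side of the peak \<open>b\<close> has no kink, \<open>a\<close> is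
    convex and \<open>h\<close> has nonnegative second differences, so \<open>w\<close> is concave
    there; it is nonnegative at the feet and zero at the peak.\<close>
  define w where "w = (\<lambda>k. u k - ((M + R) * h k - R))"
  have w2: "diff2 w k \<le> 0" if "0 < k" "k < K" "k \<noteq> t" "\<not> 0 < diff2 b k" for k
  proof -
    have "diff2 w k = diff2 b k - diff2 a k - (M + R) * diff2 h k"
      by (simp add: w_def u_def diff2_def algebra_simps)
    moreover have "0 \<le> (M + R) * diff2 h k" using h2(2)[of k] that MR_nonneg by auto
    ultimately show ?thesis using a[of k] that by auto
  qed
  have wt: "w t = 0" by (simp add: w_def h_def hat_def u_def t)
  have wnn: "0 \<le> w k" if "p \<le> k" "k \<le> q" for k
  proof (cases "k \<le> t")
    case True
    show ?thesis
    proof (cases "p < t")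
      case pt: True
      have "0 \<le> w p" using MR[of p] pt t by (simp add: w_def h_def hat_def u_def)
      then show ?thesis
        using concave_seq_nonneg[of p t w k] wt w2 p(3) True that t by auto
    next
      case False
      then show ?thesis using p(1) True that wt by auto
    qed
  next
    case False
    then have qt: "t < q" using that by auto
    have "0 \<le> w q" using MR[of q] qt q by (simp add: w_def h_def hat_def u_def)
    then show ?thesis
      using concave_seq_nonneg[of t q w k] wt w2 q(2,4) False that t by auto
  qed
  have "((M + R) * (3 / 5) - R) * S \<le> (M + R) * (\<Sum>i=1..K*m. (pl K h (real i / real m))\<^sup>2) - R * S"
  proof -
    have "3 / 5 * S \<le> (\<Sum>i=1..K*m. (pl K h (real i / real m))\<^sup>2)"
      using hat_square_sum[OF hk m] by (simp add: S_def h_def)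
    from mult_left_mono[OF this MR_nonneg] show ?thesis by (simp add: algebra_simps)
  qed
  also have "\<dots> = (\<Sum>i=1..K*m. pl K h (real i / real m) * ((M + R) * pl K h (real i / real m) - R))"
    unfolding S_def by (simp add: sum_subtractf sum_distrib_left algebra_simps power2_eq_square)
  also have "\<dots> \<le> (\<Sum>i=1..K*m. pl K h (real i / real m) * pl K u (real i / real m))"
  proof (rule sum_mono)
    fix i assume i: "i \<in> {1..K*m}"
    note z = design_range[OF i m0]
    have "0 \<le> pl K h (real i / real m) * pl K w (real i / real m)"
      unfolding h_def by (rule hat_mult_nonneg[OF hk K0]) (use z wnn in auto)
    also have "pl K w (real i / real m) = pl K u (real i / real m) - ((M + R) * pl K h (real i / real m) - R)"
      unfolding w_def pl_diff pl_scale using pl_const[OF K0] z by simp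
    finally show "pl K h (real i / real m) * ((M + R) * pl K h (real i / real m) - R)
        \<le> pl K h (real i / real m) * pl K u (real i / real m)" by (simp add: algebra_simps)
  qed
  finally have low: "(3 / 5 * M - 2 / 5 * R) * S
      \<le> (\<Sum>i=1..K*m. pl K h (real i / real m) * pl K u (real i / real m))"
    by (simp add: algebra_simps)
  have "lform K m y (\<lambda>k. - h k) \<le> qform K m lam b (\<lambda>k. - h k)"
  proof -
    have "0 \<le> diff2 (\<lambda>k. - h k) k" if "k \<in> {1..<K}" "diff2 b k = 0" for k
      using h2(1)[of k] that p(2) q(3) by (auto simp: diff2_uminus of_bool_def split: if_splits)
    then show ?thesis using st by (auto simp: stationary_def)
  qed
  moreover have "lform K m y (\<lambda>k. - h k) = - lform K m y h" "qform K m lam b (\<lambda>k. - h k) = - qform K m lam b h"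
    by (simp_all add: lform_def qform_def pl_uminus diff2_uminus sum_negf)
  ultimately have "qform K m lam b h \<le> lform K m y h" by simp
  then have up: "(\<Sum>i=1..K*m. pl K h (real i / real m) * pl K u (real i / real m))
     \<le> (\<Sum>i=1..K*m. pl K h (real i / real m) * g i) + (\<Sum>i=1..K*m. pl K h (real i / real m) * e i)
       - lam * (\<Sum>k\<in>{1..<K}. diff2 b k * diff2 h k)"
    unfolding lform_y qform_b u_def by simp
  \<comment> \<open>Away from the peak \<open>h\<close> has nonnegative second differences and the
    penalty only helps. At the peak \<open>u\<close> is maximal, so the curvature of
    \<open>b\<close> is at most that of \<open>a\<close>, hence at most \<open>C\<close>.\<close>
  have "- (\<Sum>k\<in>{1..<K}. diff2 b k * diff2 h k) \<le> (\<Sum>k\<in>{1..<K}. if k = t then 2 * C else 0)"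
    unfolding sum_negf[symmetric]
  proof (rule sum_mono)
    fix k assume k: "k \<in> {1..<K}"
    show "- (diff2 b k * diff2 h k) \<le> (if k = t then 2 * C else 0)"
    proof (cases "k = t")
      case True
      have "u (t - 1) \<le> M" "u (t + 1) \<le> M" "u t = M" using MR[of "t-1"] MR[of "t+1"] True k t by (auto simp: u_def)
      then have "diff2 b t \<le> diff2 a t" by (simp add: diff2_def u_def)
      then have "diff2 b t \<le> C" "0 \<le> diff2 b t" using a[of t] b_convex[of t] k True by auto
      moreover have "- diff2 h t \<le> 2" using h2(2)[of t] k True by auto
      ultimately have "diff2 b t * (- diff2 h t) \<le> C * 2"
        using C by (meson mult_left_mono mult_right_mono order_trans zero_le_numeral)
      then show ?thesis using True by simp
    next
      case False
      then show ?thesis using h2(2)[of k] k b_convex[of k] by auto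
    qed
  qed
  also have "\<dots> \<le> 2 * C" using C by (simp add: sum.delta)
  finally have "lam * - (\<Sum>k\<in>{1..<K}. diff2 b k * diff2 h k) \<le> lam * (2 * C)" using lam by (intro mult_left_mono) auto
  also have "\<dots> \<le> 5 * C / real K * S" unfolding S_def h_def by (rule lam_bound[OF hk C])
  finally have l: "- lam * (\<Sum>k\<in>{1..<K}. diff2 b k * diff2 h k) \<le> 5 * C / real K * S" by simp
  have bias: "(\<Sum>i=1..K*m. pl K h (real i / real m) * g i) \<le> G * S"
    unfolding S_def h_def by (rule abs_le_D1[OF hat_bias[OF K0 m0 g]])
  have noise: "(\<Sum>i=1..K*m. pl K h (real i / real m) * e i) \<le> 5 / 2 * Z / real m * S"
    unfolding S_def h_def by (rule abs_le_D1[OF hat_noise[OF hk K0 m e]])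
  have "(3 / 5 * M - 2 / 5 * R) * S \<le> err * S"
    using low up l bias noise unfolding err by (simp add: distrib_right)
  then show ?thesis using S0 by simp
qed

text \<open>A unit hat suffices, since the bound \<open>u \<le> M - (M + R) h\<close> is needed at
  the knots only, where it reads \<open>u \<le> -R\<close> at the peak and \<open>u \<le> M\<close>
  elsewhere. The extra \<open>1 / 10 * (M + R)\<close> is the price of the penalty at the
  feet.\<close>

lemma lower_deviation:
  assumes t: "t \<le> K" "b t - a t = - R"
    and first: "\<And>k. k < t \<Longrightarrow> - R < b k - a k"
  shows "3 / 5 * R - 2 / 5 * M \<le> err + 1 / 10 * (M + R)"
proof -
  have K0: "0 < K" and m0: "0 < m" using K m by auto
  define u where "u = (\<lambda>k. b k - a k)"
  define p where "p = t - 1"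
  define q where "q = min (t + 1) K"
  have hk: "hat_knots K p t q" unfolding p_def q_def by (rule hat_knots_unit[OF K0 t(1)])
  define h where "h = hat p t q"
  have hv: "h k = of_bool (k = t)" if "k \<le> K" for k
    unfolding h_def p_def q_def by (rule hat_unit[OF that t(1)])
  define S where "S = (\<Sum>i=1..K*m. pl K h (real i / real m))"
  have S0: "0 < S" unfolding S_def h_def by (rule hat_total_pos[OF hk])
  note h2 = hat_diff2[OF hk, folded h_def]
  define w where "w = (\<lambda>k. M - (M + R) * h k - u k)"
  have wnn: "0 \<le> w k" if "k \<le> K" for k
    using MR[OF that] hv[OF that] t by (cases "k = t") (auto simp: w_def u_def)
  have kink: "0 < diff2 b t" if "t \<in> {1..<K}"
  proof -
    have "- R < u (t - 1)" "- R \<le> u (t + 1)" "u t = - R"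
      using MR[of "t+1"] first[of "t-1"] that t by (auto simp: u_def)
    then have "diff2 a t < diff2 b t" by (simp add: diff2_def u_def)
    then show ?thesis using a[OF that] by simp
  qed
  have "(\<Sum>i=1..K*m. pl K h (real i / real m) * pl K u (real i / real m))
      \<le> (\<Sum>i=1..K*m. pl K h (real i / real m) * (M - (M + R) * pl K h (real i / real m)))"
  proof (rule sum_mono)
    fix i assume i: "i \<in> {1..K*m}"
    note z = design_range[OF i m0]
    have "0 \<le> pl K h (real i / real m) * pl K w (real i / real m)"
      unfolding h_def by (rule hat_mult_nonneg[OF hk K0]) (use z wnn in \<open>auto simp: q_def\<close>)
    also have "pl K w (real i / real m) = M - (M + R) * pl K h (real i / real m) - pl K u (real i / real m)"
      unfolding w_def pl_diff pl_scale using pl_const[OF K0] z by simp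
    finally show "pl K h (real i / real m) * pl K u (real i / real m)
      \<le> pl K h (real i / real m) * (M - (M + R) * pl K h (real i / real m))" by (simp add: algebra_simps)
  qed
  also have "\<dots> = M * S - (M + R) * (\<Sum>i=1..K*m. (pl K h (real i / real m))\<^sup>2)"
    unfolding S_def by (simp add: sum_subtractf sum_distrib_left algebra_simps power2_eq_square)
  also have "\<dots> \<le> (2 / 5 * M - 3 / 5 * R) * S"
  proof -
    have "3 / 5 * S \<le> (\<Sum>i=1..K*m. (pl K h (real i / real m))\<^sup>2)"
      using hat_square_sum[OF hk m] by (simp add: S_def h_def)
    from mult_left_mono[OF this MR_nonneg] show ?thesis by (simp add: algebra_simps)
  qed
  finally have low: "(\<Sum>i=1..K*m. pl K h (real i / real m) * pl K u (real i / real m)) \<le> (2 / 5 * M - 3 / 5 * R) * S" .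
  have "lform K m y h \<le> qform K m lam b h"
  proof -
    have "0 \<le> diff2 h k" if "k \<in> {1..<K}" "diff2 b k = 0" for k
      using h2(2)[of k] that kink by (cases "k = t") auto
    then show ?thesis using st by (auto simp: stationary_def)
  qed
  then have up: "(\<Sum>i=1..K*m. pl K h (real i / real m) * g i) + (\<Sum>i=1..K*m. pl K h (real i / real m) * e i)
     \<le> (\<Sum>i=1..K*m. pl K h (real i / real m) * pl K u (real i / real m))
       + lam * (\<Sum>k\<in>{1..<K}. diff2 b k * diff2 h k)"
    unfolding lform_y qform_b u_def by simp
  \<comment> \<open>At the feet nothing compares the curvature of \<open>b\<close> with that of
    \<open>a\<close>, so it is bounded through \<open>u\<close>: the outer terms of the second
    difference give \<open>2 M\<close>, the middle one \<open>2 R\<close>. Then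
    \<open>5 * B / K\<close> contains \<open>10 / K * (M + R)\<close>, which is at most
    \<open>1 / 10 * (M + R)\<close> since \<open>K \<ge> 100\<close>.\<close>
  define B where "B = 2 * (M + R) + C"
  have B0: "0 \<le> B" using MR_nonneg C by (simp add: B_def)
  have "(\<Sum>k\<in>{1..<K}. diff2 b k * diff2 h k)
      \<le> (\<Sum>k\<in>{1..<K}. (if k = p then B else 0) + (if k = q then B else 0))"
  proof (rule sum_mono)
    fix k assume k: "k \<in> {1..<K}"
    have "diff2 u k \<le> 2 * (M + R)"
      using MR[of "k-1"] MR[of k] MR[of "k+1"] k
      by (cases "k - 1 \<le> K") (auto simp: diff2_def u_def)
    then have b2: "0 \<le> diff2 b k" "diff2 b k \<le> B"
      using a[OF k] b_convex[OF k] by (auto simp: B_def u_def diff2_diff)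
    have "diff2 b k * diff2 h k \<le> diff2 b k * (of_bool (k = p) + of_bool (k = q))"
      using h2(1)[of k] k b2 by (intro mult_left_mono) auto
    also have "\<dots> \<le> B * (of_bool (k = p) + of_bool (k = q))"
      using b2 by (intro mult_right_mono) auto
    finally show "diff2 b k * diff2 h k \<le> (if k = p then B else 0) + (if k = q then B else 0)"
      by (auto simp: of_bool_def split: if_splits)
  qed
  also have "\<dots> \<le> 2 * B" using B0 by (simp add: sum.distrib sum.delta)
  finally have "lam * (\<Sum>k\<in>{1..<K}. diff2 b k * diff2 h k) \<le> lam * (2 * B)" using lam by (intro mult_left_mono) auto
  also have "\<dots> \<le> 5 * B / real K * S" unfolding S_def h_def by (rule lam_bound[OF hk B0])
  also have "\<dots> = (5 * C / real K + 10 / real K * (M + R)) * S" by (simp add: B_def add_divide_distrib algebra_simps)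
  also have "\<dots> \<le> (5 * C / real K + 1 / 10 * (M + R)) * S"
    using S0 K MR_nonneg by (intro mult_right_mono add_left_mono) (auto simp: divide_simps)
  finally have l: "lam * (\<Sum>k\<in>{1..<K}. diff2 b k * diff2 h k) \<le> (5 * C / real K + 1 / 10 * (M + R)) * S" .
  have bias: "- (\<Sum>i=1..K*m. pl K h (real i / real m) * g i) \<le> G * S"
    unfolding S_def h_def by (rule abs_le_D2[OF hat_bias[OF K0 m0 g]])
  have noise: "- (\<Sum>i=1..K*m. pl K h (real i / real m) * e i) \<le> 5 / 2 * Z / real m * S"
    unfolding S_def h_def by (rule abs_le_D2[OF hat_noise[OF hk K0 m e]])
  have "(3 / 5 * R - 2 / 5 * M) * S \<le> (err + 1 / 10 * (M + R)) * S"
    using low up l bias noise unfolding err by (simp add: distrib_right left_diff_distrib)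
  then show ?thesis using S0 by simp
qed

end

theorem uniform_stability:
  assumes "100 \<le> K" "5 \<le> m" "0 \<le> lam" "lam \<le> real m / real K"
    and "stationary K m lam y b"
    and "\<And>k. k \<in> {1..<K} \<Longrightarrow> 0 \<le> diff2 a k \<and> diff2 a k \<le> C" and "0 \<le> C"
    and "\<And>i. i \<in> {1..K*m} \<Longrightarrow> y i = pl K a (real i / real m) + g i + e i"
    and "\<And>i. i \<in> {1..K*m} \<Longrightarrow> \<bar>g i\<bar> \<le> G"
    and "\<And>k. k \<le> K \<Longrightarrow> \<bar>\<Sum>i=1..K*m. tent m k i * e i\<bar> \<le> Z"
    and k: "k \<le> K"
  shows "\<bar>b k - a k\<bar> \<le> 11 * (G + 5 / 2 * Z / real m + 5 * C / real K)"
proof -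
  obtain s where s: "s \<le> K" "\<And>k. k \<le> K \<Longrightarrow> b s - a s \<le> b k - a k" "\<And>k. k < s \<Longrightarrow> b s - a s < b k - a k"
    using first_argmin[of 0 K "\<lambda>k. b k - a k"] by (metis zero_le)
  obtain t where t': "t \<le> K" "\<And>k. k \<le> K \<Longrightarrow> - (b t - a t) \<le> - (b k - a k)"
    using first_argmin[of 0 K "\<lambda>k. - (b k - a k)"] by (metis zero_le)
  then have t: "t \<le> K" "\<And>k. k \<le> K \<Longrightarrow> b k - a k \<le> b t - a t" by fastforce+
  define M where "M = b t - a t"
  define R where "R = - (b s - a s)"
  have MR: "- R \<le> b k - a k \<and> b k - a k \<le> M" if "k \<le> K" for k
    using s t that by (auto simp: M_def R_def)
  define E where "E = G + 5 / 2 * Z / real m + 5 * C / real K"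
  have 1: "3 / 5 * M - 2 / 5 * R \<le> E"
    by (rule upper_deviation[OF assms(1-10) MR E_def t(1)]) (simp_all add: M_def)
  have 2: "3 / 5 * R - 2 / 5 * M \<le> E + 1 / 10 * (M + R)"
    by (rule lower_deviation[OF assms(1-10) MR E_def s(1)]) (use s in \<open>auto simp: R_def\<close>)
  have 3: "- R \<le> b k - a k" "b k - a k \<le> M" using MR[OF k] by auto
  then have "0 \<le> M + R" by linarith
  \<comment> \<open>Adding \<open>1\<close> and \<open>2\<close> gives
    \<open>(M + R) / 5 \<le> 2 E + (M + R) / 10\<close>. Inserting \<open>M + R \<le> 20 E\<close>
    back into \<open>1\<close> and \<open>2\<close> yields \<open>M \<le> 9 E\<close> and
    \<open>R \<le> 11 E\<close>.\<close>
  then have "M + R \<le> 20 * E" "0 \<le> E" using 1 2 by (simp_all add: field_simps)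
  then have "M \<le> 11 * E" "R \<le> 11 * E" using 1 2 by (simp_all add: field_simps)
  with 3 show ?thesis unfolding E_def[symmetric] by (simp add: abs_le_iff)
qed

section \<open>Existence and Lipschitz dependence of the minimizer\<close>

definition objective :: "nat \<Rightarrow> nat \<Rightarrow> real \<Rightarrow> (nat \<Rightarrow> real) \<Rightarrow> (nat \<Rightarrow> real) \<Rightarrow> real" where
  "objective K m lam y b = 1 / 2 * qform K m lam b b - lform K m y b"

definition minimizer :: "nat \<Rightarrow> nat \<Rightarrow> real \<Rightarrow> (nat \<Rightarrow> real) \<Rightarrow> (nat \<Rightarrow> real) \<Rightarrow> bool" where
  "minimizer K m lam y b \<longleftrightarrow> convex_seq K b \<and>
     (\<forall>c. convex_seq K c \<longrightarrow> objective K m lam y b \<le> objective K m lam y c)"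

lemma diff2_add_scale: "diff2 (\<lambda>k. b k + s * v k) k = diff2 b k + s * diff2 v k"
  by (simp add: diff2_def algebra_simps)

lemma qform_add_scale:
  "qform K m lam (\<lambda>k. b k + s * v k) (\<lambda>k. b k + s * v k)
    = qform K m lam b b + 2 * s * qform K m lam b v + s\<^sup>2 * qform K m lam v v"
  unfolding qform_def pl_add pl_scale diff2_add_scale
  by (simp add: algebra_simps power2_eq_square sum.distrib sum_distrib_left)

lemma lform_add_scale: "lform K m y (\<lambda>k. b k + s * v k) = lform K m y b + s * lform K m y v"
  unfolding lform_def pl_add pl_scale
  by (simp add: algebra_simps sum.distrib sum_distrib_left)

lemma objective_add_scale:
  "objective K m lam y (\<lambda>k. b k + s * v k) = objective K m lam y b
     + s * (qform K m lam b v - lform K m y v) + s\<^sup>2 / 2 * qform K m lam v v"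
  unfolding objective_def qform_add_scale lform_add_scale by (simp add: algebra_simps)

text \<open>A constraint that holds strictly survives a small step, and there are finitely many of
  them. Dividing the change of the objective by the step and letting it tend to \<open>0\<close>
  leaves the directional derivative.\<close>

lemma minimizer_stationary:
  assumes min: "minimizer K m lam y b"
  shows "stationary K m lam y b"
  unfolding stationary_def
proof (intro conjI allI impI)
  show cb: "convex_seq K b" using min by (simp add: minimizer_def)
  fix v assume v: "\<forall>k\<in>{1..<K}. diff2 b k = 0 \<longrightarrow> 0 \<le> diff2 v k"
  let ?d = "qform K m lam b v - lform K m y v" and ?q = "qform K m lam v v"
  have "\<forall>\<^sub>F s in at_right 0. \<forall>k\<in>{1..<K}. 0 \<le> diff2 b k + s * diff2 v k"
  proof (rule eventually_ball_finite, simp, rule ballI)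
    fix k assume k: "k \<in> {1..<K}"
    show "\<forall>\<^sub>F s in at_right 0. 0 \<le> diff2 b k + s * diff2 v k"
    proof (cases "diff2 b k = 0")
      case True
      then have "0 \<le> diff2 v k" using v k by auto
      then show ?thesis using True by (auto simp: eventually_at_right_less intro: eventually_mono[OF eventually_at_right_less])
    next
      case False
      then have pos: "0 < diff2 b k" using cb k by (force simp: convex_seq_def)
      have "((\<lambda>s. diff2 b k + s * diff2 v k) \<longlongrightarrow> diff2 b k + 0 * diff2 v k) (at_right 0)"
        by (intro tendsto_intros)
      then have "\<forall>\<^sub>F s in at_right 0. 0 < diff2 b k + s * diff2 v k"
        by (rule order_tendstoD) (use pos in simp)
      then show ?thesis by (rule eventually_mono) simp
    qed
  qed
  then have ev: "\<forall>\<^sub>F s in at_right 0. 0 \<le> ?d + s / 2 * ?q"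
    using eventually_at_right_less
  proof eventually_elim
    case (elim s)
    have "convex_seq K (\<lambda>k. b k + s * v k)"
      using elim by (simp add: convex_seq_def diff2_add_scale)
    then have "objective K m lam y b \<le> objective K m lam y (\<lambda>k. b k + s * v k)"
      using min by (simp add: minimizer_def)
    then have "0 \<le> s * (?d + s / 2 * ?q)"
      unfolding objective_add_scale by (simp add: algebra_simps power2_eq_square)
    then show ?case using elim(2) by (simp add: zero_le_mult_iff)
  qed
  have "((\<lambda>s. ?d + s / 2 * ?q) \<longlongrightarrow> ?d + 0 / 2 * ?q) (at_right 0)"
    by (intro tendsto_intros) auto
  from tendsto_lowerbound[OF this ev] show "lform K m y v \<le> qform K m lam b v" by simp
qed

lemma qform_ge:
  assumes "0 \<le> lam"
  shows "(\<Sum>i=1..K*m. (pl K b (real i / real m))\<^sup>2) \<le> qform K m lam b b"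
  using assms unfolding qform_def power2_eq_square
  by (simp add: mult_nonneg_nonneg sum_nonneg)

text \<open>All knots but \<open>0\<close> are design points. The value \<open>b 0\<close> is
  recovered from the first design point, where it has weight \<open>1 - 1 / m \<ge> 1 / 2\<close>
  and \<open>b 1\<close> has weight at most \<open>1 / 2\<close>; hence the factor
  \<open>3 = 2 (1 + 1 / 2)\<close>.\<close>

lemma coeff_bound:
  assumes "0 < K" "2 \<le> m" and B: "\<And>i. i \<in> {1..K*m} \<Longrightarrow> \<bar>pl K b (real i / real m)\<bar> \<le> B" and k: "k \<le> K"
  shows "\<bar>b k\<bar> \<le> 3 * B"
proof -
  have pos: "\<bar>b k\<bar> \<le> B" if "1 \<le> k" "k \<le> K" for k
  proof -
    have "1 * 1 \<le> k * m" "k * m \<le> K * m" using that assms by (intro mult_le_mono; simp)+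
    then have "\<bar>pl K b (real (k * m) / real m)\<bar> \<le> B" by (intro B) auto
    then show ?thesis using pl_knot[OF that(2), of b] assms by simp
  qed
  show ?thesis
  proof (cases "k = 0")
    case False
    then show ?thesis using pos[of k] k by auto
  next
    case True
    have "1 * 1 \<le> K * m" using assms by (intro mult_le_mono) auto
    then have "\<bar>pl K b (real 1 / real m)\<bar> \<le> B" by (intro B) auto
    moreover have "pl K b (real 1 / real m) = (1 - 1 / real m) * b 0 + 1 / real m * b 1"
      using pl_cell[of 0 K "real 1 / real m" b] assms by simp
    moreover have "\<bar>b 1\<bar> \<le> B" using pos[of 1] assms by auto
    ultimately have "\<bar>(1 - 1 / real m) * b 0 + 1 / real m * b 1\<bar> \<le> B" "\<bar>b 1\<bar> \<le> B" by auto
    moreover have "\<bar>1 / real m * b 1\<bar> \<le> 1 / 2 * B"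
      unfolding abs_mult using assms \<open>\<bar>b 1\<bar> \<le> B\<close> by (intro mult_mono) (auto simp: field_simps)
    ultimately have "\<bar>(1 - 1 / real m) * b 0\<bar> \<le> 3 / 2 * B" by linarith
    moreover have "1 / 2 * \<bar>b 0\<bar> \<le> \<bar>(1 - 1 / real m) * b 0\<bar>"
      unfolding abs_mult using assms by (intro mult_right_mono) (auto simp: field_simps)
    ultimately show ?thesis using True by simp
  qed
qed

lemma coeff_bound_square:
  assumes "0 < K" "2 \<le> m" and B: "(\<Sum>i=1..K*m. (pl K b (real i / real m))\<^sup>2) \<le> B\<^sup>2" "0 \<le> B" and k: "k \<le> K"
  shows "\<bar>b k\<bar> \<le> 3 * B"
proof (rule coeff_bound[OF assms(1,2) _ k])
  fix i assume i: "i \<in> {1..K*m}"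
  have "(pl K b (real i / real m))\<^sup>2 \<le> (\<Sum>i=1..K*m. (pl K b (real i / real m))\<^sup>2)"
    by (rule member_le_sum) (use i in auto)
  then have "(pl K b (real i / real m))\<^sup>2 \<le> B\<^sup>2" using B by simp
  then show "\<bar>pl K b (real i / real m)\<bar> \<le> B" using B(2) by (simp add: abs_le_square_iff[symmetric])
qed

lemma qform_uminus_right: "qform K m lam b (\<lambda>k. - c k) = - qform K m lam b c"
  by (simp add: qform_def pl_uminus diff2_uminus sum_negf)

lemma lform_uminus: "lform K m y (\<lambda>k. - c k) = - lform K m y c"
  by (simp add: lform_def pl_uminus sum_negf)

lemma qform_diff_left: "qform K m lam (\<lambda>k. b k - b' k) c = qform K m lam b c - qform K m lam b' c"
  by (simp add: qform_def pl_diff diff2_diff sum_subtractf algebra_simps)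

text \<open>Each solution is tested in the direction of the other one, which is admissible because
  the other one is convex; adding the two inequalities bounds the quadratic form of the difference.
  The result makes the estimator a continuous function of the errors, from which its measurability
  is derived.\<close>

lemma stationary_Lipschitz:
  assumes K: "0 < K" "2 \<le> m" and lam: "0 \<le> lam"
    and st: "stationary K m lam y b" "stationary K m lam y' b'" and k: "k \<le> K"
  shows "\<bar>b k - b' k\<bar> \<le> 3 * (\<Sum>i=1..K*m. \<bar>y i - y' i\<bar>)"
proof -
  define d where "d = (\<lambda>k. b k - b' k)"
  define S where "S = (\<Sum>i=1..K*m. (pl K d (real i / real m))\<^sup>2)"
  define D where "D = (\<Sum>i=1..K*m. \<bar>y i - y' i\<bar>)"
  have S0: "0 \<le> S" "0 \<le> D" by (auto simp: S_def D_def intro!: sum_nonneg)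
  have "\<forall>k\<in>{1..<K}. diff2 b k = 0 \<longrightarrow> 0 \<le> diff2 (\<lambda>k. - d k) k"
    using st(2) by (auto simp: stationary_def convex_seq_def d_def diff2_diff diff2_uminus)
  then have 1: "lform K m y (\<lambda>k. - d k) \<le> qform K m lam b (\<lambda>k. - d k)"
    using st(1) by (auto simp: stationary_def)
  have "\<forall>k\<in>{1..<K}. diff2 b' k = 0 \<longrightarrow> 0 \<le> diff2 d k"
    using st(1) by (auto simp: stationary_def convex_seq_def d_def diff2_diff)
  then have 2: "lform K m y' d \<le> qform K m lam b' d"
    using st(2) by (auto simp: stationary_def)
  have "S \<le> qform K m lam d d" unfolding S_def by (rule qform_ge[OF lam])
  also have "\<dots> = qform K m lam b d - qform K m lam b' d"
    using qform_diff_left[of K m lam b b' d] by (simp add: d_def)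
  also have "\<dots> \<le> lform K m y d - lform K m y' d" using 1 2 by (simp add: qform_uminus_right lform_uminus)
  also have "\<dots> = (\<Sum>i=1..K*m. pl K d (real i / real m) * (y i - y' i))"
    by (simp add: lform_def sum_subtractf algebra_simps)
  also have "\<dots> \<le> (\<Sum>i=1..K*m. sqrt S * \<bar>y i - y' i\<bar>)"
  proof (rule sum_mono)
    fix i assume i: "i \<in> {1..K*m}"
    have "(pl K d (real i / real m))\<^sup>2 \<le> S"
      unfolding S_def by (rule member_le_sum) (use i in auto)
    then have "\<bar>pl K d (real i / real m)\<bar> \<le> sqrt S" using real_sqrt_le_mono by fastforce
    then have "\<bar>pl K d (real i / real m) * (y i - y' i)\<bar> \<le> sqrt S * \<bar>y i - y' i\<bar>"
      unfolding abs_mult by (rule mult_right_mono) simp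
    then show "pl K d (real i / real m) * (y i - y' i) \<le> sqrt S * \<bar>y i - y' i\<bar>" by linarith
  qed
  also have "\<dots> = sqrt S * D" by (simp add: D_def sum_distrib_left)
  finally have "sqrt S * sqrt S \<le> sqrt S * D" using S0 by simp
  then have "sqrt S \<le> D" using S0 by (cases "S = 0") (simp, rule mult_left_le_imp_le[of "sqrt S"], simp_all)
  then have "S \<le> D\<^sup>2" using S0 by (simp add: sqrt_le_D)
  then show ?thesis using coeff_bound_square[OF K, of d D k] S0 k by (simp add: S_def d_def D_def)
qed

lemma objective_lower_bound:
  assumes "0 \<le> lam"
  shows "- (1 / 2) * (\<Sum>i=1..K*m. (y i)\<^sup>2) \<le> objective K m lam y b"
proof -
  have "0 \<le> (\<Sum>i=1..K*m. (pl K b (real i / real m) - y i)\<^sup>2)" by (intro sum_nonneg) auto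
  also have "\<dots> = (\<Sum>i=1..K*m. (pl K b (real i / real m))\<^sup>2) - 2 * lform K m y b + (\<Sum>i=1..K*m. (y i)\<^sup>2)"
    by (simp add: lform_def power2_diff sum.distrib sum_subtractf sum_distrib_left algebra_simps)
  also have "\<dots> \<le> qform K m lam b b - 2 * lform K m y b + (\<Sum>i=1..K*m. (y i)\<^sup>2)"
    using qform_ge[OF assms, of K b m] by simp
  finally show ?thesis by (simp add: objective_def)
qed

text \<open>By the parallelogram identity.\<close>

lemma minimizing_sequence_Cauchy:
  assumes K: "0 < K" "2 \<le> m" and lam: "0 \<le> lam"
    and I: "\<And>c. convex_seq K c \<Longrightarrow> I \<le> objective K m lam y c"
    and b: "convex_seq K b" "objective K m lam y b \<le> I + \<delta>"
    and c: "convex_seq K c" "objective K m lam y c \<le> I + \<delta>" and k: "k \<le> K"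
  shows "\<bar>b k - c k\<bar> \<le> 3 * sqrt (8 * \<delta>)"
proof -
  define d where "d = (\<lambda>k. c k - b k)"
  have \<delta>: "0 \<le> \<delta>" using I[OF b(1)] b(2) by simp
  have c': "c = (\<lambda>k. b k + 1 * d k)" by (simp add: d_def)
  have mid: "convex_seq K (\<lambda>k. b k + (1/2) * d k)"
    unfolding convex_seq_def diff2_add_scale using b(1)[unfolded convex_seq_def] c(1)[unfolded convex_seq_def]
    by (auto simp: d_def diff2_diff diff_divide_distrib)
  have "8 * (objective K m lam y (\<lambda>k. b k + (1/2) * d k)) = 4 * objective K m lam y b
      + 4 * objective K m lam y c - qform K m lam d d"
    unfolding c' objective_add_scale by (simp add: power2_eq_square algebra_simps)
  then have "qform K m lam d d \<le> 8 * \<delta>" using I[OF mid] b(2) c(2) by linarith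
  then have "(\<Sum>i=1..K*m. (pl K d (real i / real m))\<^sup>2) \<le> (sqrt (8 * \<delta>))\<^sup>2"
    using qform_ge[OF lam, of K d m] \<delta> by simp
  then have "\<bar>d k\<bar> \<le> 3 * sqrt (8 * \<delta>)" using coeff_bound_square[OF K _ _ k] \<delta> by simp
  then show ?thesis by (simp add: d_def abs_minus_commute)
qed

text \<open>\<open>ARG_MIN\<close> is an unspecified value unless the minimum is attained. A
  minimizing sequence is Cauchy at every knot, and constraints and objective are continuous in these
  finitely many values.\<close>

lemma minimizer_exists:
  assumes K: "0 < K" "2 \<le> m" and lam: "0 \<le> lam"
  shows "\<exists>b. minimizer K m lam y b"
proof -
  let ?J = "objective K m lam y"
  let ?A = "?J ` {b. convex_seq K b}"
  have z: "convex_seq K (\<lambda>_. 0)" by (simp add: convex_seq_def diff2_def)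
  have bdd: "bdd_below ?A" using objective_lower_bound[OF lam] by (intro bdd_belowI2)
  define I where "I = Inf ?A"
  have I: "I \<le> ?J c" if "convex_seq K c" for c
    unfolding I_def by (rule cInf_lower[OF _ bdd]) (use that in auto)
  have "\<exists>b. convex_seq K b \<and> ?J b < I + 1 / real (Suc j)" for j
  proof -
    have "Inf ?A < I + 1 / real (Suc j)" by (simp add: I_def)
    then obtain x where "x \<in> ?A" "x < I + 1 / real (Suc j)"
      using cInf_lessD[of ?A] z by blast
    then show ?thesis by auto
  qed
  then obtain bs where bs: "\<And>j. convex_seq K (bs j)" "\<And>j. ?J (bs j) < I + 1 / real (Suc j)" by metis
  have conv: "\<exists>l. (\<lambda>j. bs j k) \<longlonglongrightarrow> l" if k: "k \<le> K" for k
  proof -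
    have "Cauchy (\<lambda>j. bs j k)"
    proof (rule metric_CauchyI)
      fix e :: real assume e: "0 < e"
      \<comment> \<open>\<open>72 = 9 * 8\<close> inverts the modulus
        \<open>3 * sqrt (8 * \<delta>)\<close> of \<open>minimizing_sequence_Cauchy\<close>.\<close>
      obtain N where N: "inverse (real (Suc N)) < e\<^sup>2 / 72" using reals_Archimedean[of "e\<^sup>2 / 72"] e by auto
      have "3 * sqrt (8 * (1 / real (Suc N))) < e"
      proof -
        have N': "8 * (1 / real (Suc N)) < (e / 3)\<^sup>2" using N by (simp add: inverse_eq_divide power_divide)
        then have "sqrt (8 * (1 / real (Suc N))) < e / 3" 
          by (rule real_less_lsqrt[rotated]) (use e in simp)
        then show ?thesis by simp
      qed
      moreover have "\<bar>bs i k - bs j k\<bar> \<le> 3 * sqrt (8 * (1 / real (Suc N)))" if "N \<le> i" "N \<le> j" for i j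
      proof (rule minimizing_sequence_Cauchy[OF K lam I bs(1) _ bs(1) _ k])
        have *: "1 / real (Suc i) \<le> 1 / real (Suc N)" if "N \<le> i" for i using that by (simp add: frac_le)
        show "?J (bs i) \<le> I + 1 / real (Suc N)" "?J (bs j) \<le> I + 1 / real (Suc N)"
          using bs(2)[of i] bs(2)[of j] *[OF \<open>N \<le> i\<close>] *[OF \<open>N \<le> j\<close>] by linarith+
      qed
      ultimately show "\<exists>N. \<forall>i\<ge>N. \<forall>j\<ge>N. dist (bs i k) (bs j k) < e"
        by (intro exI[of _ N]) (fastforce simp: dist_real_def)
    qed
    then show ?thesis using real_Cauchy_convergent convergent_def by blast
  qed
  then obtain l where l: "\<And>k. k \<le> K \<Longrightarrow> (\<lambda>j. bs j k) \<longlonglongrightarrow> l k" by metis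
  have d2: "(\<lambda>j. diff2 (bs j) k) \<longlonglongrightarrow> diff2 l k" if "k \<in> {1..<K}" for k
    unfolding diff2_def using that by (intro tendsto_intros l) auto
  have p: "(\<lambda>j. pl K (bs j) x) \<longlonglongrightarrow> pl K l x" for x
    unfolding pl_def by (intro tendsto_intros l) auto
  have J: "(\<lambda>j. ?J (bs j)) \<longlonglongrightarrow> ?J l"
    unfolding objective_def qform_def lform_def by (intro tendsto_intros p d2) auto
  have "(\<lambda>j. I + 1 / real (Suc j)) \<longlonglongrightarrow> I + 0"
    by (intro tendsto_intros LIMSEQ_Suc lim_1_over_n)
  from tendsto_le[OF _ this J] have "?J l \<le> I + 0"
    using bs(2) by (simp add: less_imp_le)
  moreover have "convex_seq K l"
    unfolding convex_seq_def
  proof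
    fix k assume k: "k \<in> {1..<K}"
    show "0 \<le> diff2 l k"
      by (rule tendsto_lowerbound[OF d2[OF k]]) (use bs(1) k in \<open>auto simp: convex_seq_def\<close>)
  qed
  ultimately show ?thesis using I by (intro exI[of _ l]) (force simp: minimizer_def)
qed

section \<open>From the matrix formulation to sequences\<close>

lemma bspline_design:
  assumes "0 < K" "0 < m"
  shows "bspline K (Suc k) (design_pt (K * m) i) = tent m k i"
  using assms by (simp add: bspline_def design_pt_def tent_def)

lemma design_mult_vec:
  assumes "0 < K" "0 < m" "b \<in> carrier_vec (K + 1)" "i < K * m"
  shows "(design_mat (K * m) K *\<^sub>v b) $ i = pl K (($) b) (real (Suc i) / real m)"
proof -
  have "(design_mat (K * m) K *\<^sub>v b) $ i = (\<Sum>k<Suc K. bspline K (Suc k) (design_pt (K * m) (Suc i)) * b $ k)"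
    using assms by (simp add: design_mat_def scalar_prod_def atLeast0LessThan)
  also have "\<dots> = pl K (($) b) (real (Suc i) / real m)"
    unfolding pl_tent bspline_design[OF assms(1,2)] lessThan_Suc_atMost by (simp add: mult.commute)
  finally show ?thesis .
qed

lemma diff2_mult_vec:
  assumes "b \<in> carrier_vec (K + 1)" "i < K - 1"
  shows "(diff2_mat K *\<^sub>v b) $ i = diff2 (($) b) (Suc i)"
proof -
  have "(diff2_mat K *\<^sub>v b) $ i
      = (\<Sum>j<Suc K. (if j = i then 1 else if j = i + 1 then - 2 else if j = i + 2 then 1 else 0) * b $ j)"
    using assms by (simp add: diff2_mat_def scalar_prod_def atLeast0LessThan)
  also have "\<dots> = (\<Sum>j\<in>{i, i+1, i+2}. (if j = i then 1 else if j = i + 1 then - 2 else if j = i + 2 then 1 else 0) * b $ j)"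
    using assms by (intro sum.mono_neutral_right) auto
  also have "\<dots> = diff2 (($) b) (Suc i)" by (simp add: diff2_def)
  finally show ?thesis .
qed

lemma convex_coeffs_iff:
  assumes "b \<in> carrier_vec (K + 1)"
  shows "b \<in> convex_coeffs K \<longleftrightarrow> convex_seq K (($) b)"
proof -
  have "b \<in> convex_coeffs K \<longleftrightarrow> (\<forall>i<K - 1. 0 \<le> (diff2_mat K *\<^sub>v b) $ i)"
    using assms by (auto simp: convex_coeffs_def less_eq_vec_def diff2_mat_def)
  also have "\<dots> \<longleftrightarrow> (\<forall>i<K - 1. 0 \<le> diff2 (($) b) (Suc i))"
    using diff2_mult_vec[OF assms] by auto
  also have "\<dots> \<longleftrightarrow> (\<forall>k\<in>{1..<K}. 0 \<le> diff2 (($) b) k)"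
  proof safe
    fix k assume "\<forall>i<K - 1. 0 \<le> diff2 (($) b) (Suc i)" "k \<in> {1..<K}"
    then show "0 \<le> diff2 (($) b) k" by (cases k) auto
  qed auto
  finally show ?thesis by (simp add: convex_seq_def)
qed

lemma sum_shift1: "(\<Sum>i<n. f (Suc i)) = (\<Sum>i=1..n. f i)" for f :: "nat \<Rightarrow> real"
  by (simp add: sum.atLeast1_atMost_eq)

lemma beta_eq:
  assumes "0 < K" "0 < m"
  shows "beta (K * m) K = (\<Sum>i=1..K*m. (tent m 1 i)\<^sup>2)"
  using bspline_design[OF assms, of 1] unfolding beta_def by (simp add: numeral_2_eq_2[symmetric])

lemma beta_pos:
  assumes "2 \<le> K" "0 < m"
  shows "0 < beta (K * m) K"
proof -
  have eq: "beta (K * m) K = (\<Sum>i=1..K*m. (tent m 1 i)\<^sup>2)"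
    by (rule beta_eq) (use assms in auto)
  have "1 * m \<le> K * m" using assms by (intro mult_le_mono) auto
  then have "(tent m 1 m)\<^sup>2 \<le> (\<Sum>i=1..K*m. (tent m 1 i)\<^sup>2)"
    using assms by (intro member_le_sum) auto
  moreover have "tent m 1 m = 1" using assms by (simp add: tent_def)
  ultimately show ?thesis by (simp add: eq)
qed

lemma beta_le:
  assumes "2 \<le> K" "0 < m"
  shows "beta (K * m) K \<le> real m"
  using beta_eq[of K m] tent_square_sum_le[of K 1 m] assms by simp

lemma smult_mat_mult_vec:
  fixes A :: "real mat"
  assumes "A \<in> carrier_mat r c" "b \<in> carrier_vec c"
  shows "(s \<cdot>\<^sub>m A) *\<^sub>v b = s \<cdot>\<^sub>v (A *\<^sub>v b)"
  using assms by (intro eq_vecI) (auto simp: scalar_prod_def sum_distrib_left mult.assoc)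

text \<open>Gram matrix, penalty and response all carry the factor \<open>1 / beta\<close>, so both
  objectives have the same minimizers, \<open>beta\<close> being positive.\<close>

lemma objective_vec:
  assumes K: "2 \<le> K" "0 < m" and b: "b \<in> carrier_vec (K + 1)" and y: "y \<in> carrier_vec (K * m)"
  shows "1/2 * (b \<bullet> (penalized_Gram (K * m) K lam *\<^sub>v b)) - b \<bullet> weighted_response (K * m) K y
     = objective K m lam (\<lambda>i. y $ (i - 1)) (($) b) / beta (K * m) K"
proof -
  let ?n = "K * m" and ?X = "design_mat (K * m) K" and ?D = "diff2_mat K" and ?\<beta> = "beta (K * m) K"
  have K0: "0 < K" using K by simp
  have X: "?X \<in> carrier_mat ?n (K + 1)" and D: "?D \<in> carrier_mat (K - 1) (K + 1)"
    by (auto simp: design_mat_def diff2_mat_def)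
  have quad: "b \<bullet> ((transpose_mat A * A) *\<^sub>v b) = (A *\<^sub>v b) \<bullet> (A *\<^sub>v b)" if A: "A \<in> carrier_mat r (K + 1)" for A r
  proof -
    have "(transpose_mat A * A) *\<^sub>v b = transpose_mat A *\<^sub>v (A *\<^sub>v b)"
      using A b by (intro assoc_mult_mat_vec) auto
    then have "b \<bullet> ((transpose_mat A * A) *\<^sub>v b) = (transpose_mat A *\<^sub>v (A *\<^sub>v b)) \<bullet> b"
      using A b by (simp add: comm_scalar_prod[of _ "K + 1"])
    also have "\<dots> = (A *\<^sub>v b) \<bullet> (A *\<^sub>v b)"
      using A b by (intro transpose_vec_mult_scalar) auto
    finally show ?thesis .
  qed
  have "penalized_Gram ?n K lam *\<^sub>v b
     = (1 / ?\<beta>) \<cdot>\<^sub>v ((transpose_mat ?X * ?X) *\<^sub>v b) + (lam / ?\<beta>) \<cdot>\<^sub>v ((transpose_mat ?D * ?D) *\<^sub>v b)"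
    unfolding penalized_Gram_def Gram_def using X D b
    by (subst add_mult_distrib_mat_vec[of _ "K + 1" "K + 1"])
      (auto simp: smult_mat_mult_vec[of _ "K + 1" "K + 1"])
  then have "b \<bullet> (penalized_Gram ?n K lam *\<^sub>v b)
     = (1 / ?\<beta>) * ((?X *\<^sub>v b) \<bullet> (?X *\<^sub>v b)) + (lam / ?\<beta>) * ((?D *\<^sub>v b) \<bullet> (?D *\<^sub>v b))"
    using X D b quad[OF X] quad[OF D] by (simp add: scalar_prod_add_distrib[of _ "K + 1"])
  also have "(?X *\<^sub>v b) \<bullet> (?X *\<^sub>v b)
      = (\<Sum>i<?n. pl K (($) b) (real (Suc i) / real m) * pl K (($) b) (real (Suc i) / real m))"
    unfolding scalar_prod_def using X design_mult_vec[OF K0 K(2) b]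
    by (simp add: atLeast0LessThan)
  also have "\<dots> = (\<Sum>i=1..?n. pl K (($) b) (real i / real m) * pl K (($) b) (real i / real m))"
    by (rule sum_shift1)
  also have "(?D *\<^sub>v b) \<bullet> (?D *\<^sub>v b) = (\<Sum>i<K - 1. diff2 (($) b) (Suc i) * diff2 (($) b) (Suc i))"
    unfolding scalar_prod_def using D diff2_mult_vec[OF b]
    by (simp add: atLeast0LessThan)
  also have "\<dots> = (\<Sum>k=1..K - 1. diff2 (($) b) k * diff2 (($) b) k)"
    by (rule sum_shift1)
  also have "{1..K - 1} = {1..<K}" using K by auto
  finally have q: "b \<bullet> (penalized_Gram ?n K lam *\<^sub>v b) = qform K m lam (($) b) (($) b) / ?\<beta>"
    by (simp add: qform_def add_divide_distrib)
  have "b \<bullet> weighted_response ?n K y = (1 / ?\<beta>) * ((transpose_mat ?X *\<^sub>v y) \<bullet> b)"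
    unfolding weighted_response_def using X b y by (simp add: comm_scalar_prod[of b "K + 1"])
  also have "(transpose_mat ?X *\<^sub>v y) \<bullet> b = y \<bullet> (?X *\<^sub>v b)"
    using X b y by (intro transpose_vec_mult_scalar) auto
  also have "\<dots> = (\<Sum>i<?n. pl K (($) b) (real (Suc i) / real m) * y $ (Suc i - 1))"
    unfolding scalar_prod_def using X y design_mult_vec[OF K0 K(2) b]
    by (simp add: atLeast0LessThan mult.commute)
  also have "\<dots> = lform K m (\<lambda>i. y $ (i - 1)) (($) b)"
    unfolding lform_def by (rule sum_shift1)
  finally show ?thesis unfolding q objective_def by (simp add: diff_divide_distrib)
qed

lemma objective_cong:
  assumes "\<And>k. k \<le> K \<Longrightarrow> b k = c k"
  shows "objective K m lam y b = objective K m lam y c" "convex_seq K b \<longleftrightarrow> convex_seq K c"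
proof -
  have p: "pl K b = pl K c" unfolding pl_def using assms by (intro ext sum.cong) auto
  have d: "diff2 b k = diff2 c k" if "k \<in> {1..<K}" for k 
    using that assms[of "k - 1"] assms[of k] assms[of "k + 1"] by (auto simp: diff2_def)
  show "objective K m lam y b = objective K m lam y c"
    by (simp add: objective_def qform_def lform_def p d)
  show "convex_seq K b \<longleftrightarrow> convex_seq K c" by (simp add: convex_seq_def d)
qed

lemma coeff_estimator_minimizer:
  assumes K: "2 \<le> K" "2 \<le> m" and lam: "0 \<le> lam" and y: "y \<in> carrier_vec (K * m)"
  shows "minimizer K m lam (\<lambda>i. y $ (i - 1)) (($) (coeff_estimator (K * m) K lam y))"
proof -
  let ?y = "\<lambda>i. y $ (i - 1)" and ?\<beta> = "beta (K * m) K"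
  let ?F = "\<lambda>b. 1/2 * (b \<bullet> (penalized_Gram (K * m) K lam *\<^sub>v b)) - b \<bullet> weighted_response (K * m) K y"
  have K': "0 < K" "0 < m" using K by auto
  have \<beta>: "0 < ?\<beta>" using beta_pos K by simp
  have cc: "b \<in> carrier_vec (K + 1)" if "b \<in> convex_coeffs K" for b
    using that by (simp add: convex_coeffs_def)
  have F: "?F b = objective K m lam ?y (($) b) / ?\<beta>" if "b \<in> carrier_vec (K + 1)" for b
    using objective_vec[OF K(1) K'(2) that y] .
  \<comment> \<open>Sequences are total, but only their values up to \<open>K\<close> enter the
    constraints and the objective, so cutting them down to a vector changes neither.\<close>
  have lift: "vec (K + 1) c \<in> convex_coeffs K"
    "objective K m lam ?y (($) (vec (K + 1) c)) = objective K m lam ?y c" if "convex_seq K c" for c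
    using objective_cong[of K "($) (vec (K + 1) c)" c] that convex_coeffs_iff[of "vec (K + 1) c" K] by auto
  obtain c where c: "minimizer K m lam ?y c" using minimizer_exists[OF K'(1) K(2) lam] by blast
  have "is_arg_min ?F (\<lambda>b. b \<in> convex_coeffs K) (vec (K + 1) c)"
    unfolding is_arg_min_def
  proof (intro conjI notI)
    have cs: "convex_seq K c" using c by (simp add: minimizer_def)
    show "vec (K + 1) c \<in> convex_coeffs K" by (rule lift(1)[OF cs])
    assume "\<exists>b. b \<in> convex_coeffs K \<and> ?F b < ?F (vec (K + 1) c)"
    then obtain b where b: "b \<in> convex_coeffs K" "?F b < ?F (vec (K + 1) c)" by blast
    then have "objective K m lam ?y (($) b) < objective K m lam ?y c"
      using \<beta> unfolding F[OF cc[OF b(1)]] F[OF vec_carrier] lift(2)[OF cs] by (simp add: divide_less_cancel)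
    moreover have "convex_seq K (($) b)" using b(1) cc convex_coeffs_iff by blast
    ultimately show False using c by (force simp: minimizer_def)
  qed
  then have "is_arg_min ?F (\<lambda>b. b \<in> convex_coeffs K) (coeff_estimator (K * m) K lam y)"
    unfolding coeff_estimator_def arg_min_def by (rule someI)
  then have b: "coeff_estimator (K * m) K lam y \<in> convex_coeffs K"
    "\<And>c. c \<in> convex_coeffs K \<Longrightarrow> ?F (coeff_estimator (K * m) K lam y) \<le> ?F c"
    by (auto simp: is_arg_min_def not_less)
  show ?thesis
    unfolding minimizer_def
  proof (intro conjI allI impI)
    show "convex_seq K (($) (coeff_estimator (K * m) K lam y))" using b(1) cc convex_coeffs_iff by blast
    fix c assume c: "convex_seq K c"
    show "objective K m lam ?y (($) (coeff_estimator (K * m) K lam y)) \<le> objective K m lam ?y c"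
      using b(2)[OF lift(1)[OF c]] \<beta> unfolding F[OF cc[OF b(1)]] F[OF vec_carrier] lift(2)[OF c]
      by (simp add: divide_le_cancel)
  qed
qed

lemma pspline_estimator_pl:
  "pspline_estimator n K lam y x = pl K (($) (coeff_estimator n K lam y)) (real K * x)"
proof -
  have "pspline_estimator n K lam y x
      = (\<Sum>k<Suc K. coeff_estimator n K lam y $ (Suc k - 1) * bspline K (Suc k) x)"
    unfolding pspline_estimator_def by (subst sum_shift1) simp
  then show ?thesis by (simp only: lessThan_Suc_atMost) (simp add: pl_def bspline_def)
qed

section \<open>Approximation of convex Hoelder functions\<close>

text \<open>By the mean value theorem both chord slopes are values of the derivative inside
  \<open>[lo, hi]\<close>. Adjacent chords give the bound on second differences; a chord of a cell
  and a shorter one from the same left end give the interpolation error.\<close>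

lemma convex_holder_slopes:
  assumes f: "f \<in> convex_holder r L" and r: "1 < r" and L: "0 < L"
    and lo: "0 \<le> lo" and hi: "hi \<le> 1"
    and u: "lo \<le> u" "u < v" "v \<le> hi" and w: "lo \<le> w" "w < z" "z \<le> hi"
  shows "\<bar>(f v - f u) / (v - u) - (f z - f w) / (z - w)\<bar> \<le> L * (hi - lo) powr (r - 1)"
proof -
  obtain f' where f': "\<And>x. x \<in> {0..1} \<Longrightarrow> (f has_real_derivative f' x) (at x within {0..1})"
    and H: "\<And>x1 x2. x1 \<in> {0..1} \<Longrightarrow> x2 \<in> {0..1} \<Longrightarrow> \<bar>f' x1 - f' x2\<bar> \<le> L * \<bar>x1 - x2\<bar> powr (r - 1)"
    using f unfolding convex_holder_def mem_Collect_eq by blast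
  have mv: "\<exists>\<xi>. lo \<le> \<xi> \<and> \<xi> \<le> hi \<and> (f b - f a) / (b - a) = f' \<xi>" if ab: "lo \<le> a" "a < b" "b \<le> hi" for a b
  proof -
    have "\<exists>\<xi>\<in>{a<..<b}. f b - f a = f' \<xi> * (b - a)"
    proof (rule mvt_simple[OF ab(2)])
      fix x assume "a \<le> x" "x \<le> b"
      then have "(f has_real_derivative f' x) (at x within {0..1})" using f' ab lo hi by auto
      then have "(f has_real_derivative f' x) (at x within {a..b})"
        by (rule DERIV_subset) (use ab lo hi in auto)
      then show "(f has_derivative (*) (f' x)) (at x within {a..b})" by (simp add: has_field_derivative_def)
    qed
    then obtain \<xi> where "a < \<xi>" "\<xi> < b" "f b - f a = f' \<xi> * (b - a)" by auto
    then show ?thesis using ab by (intro exI[of _ \<xi>]) simp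
  qed
  obtain \<xi> \<zeta> where \<xi>: "lo \<le> \<xi>" "\<xi> \<le> hi" "(f v - f u) / (v - u) = f' \<xi>"
    and \<zeta>: "lo \<le> \<zeta>" "\<zeta> \<le> hi" "(f z - f w) / (z - w) = f' \<zeta>"
    using mv[OF u] mv[OF w] by blast
  have "\<bar>f' \<xi> - f' \<zeta>\<bar> \<le> L * \<bar>\<xi> - \<zeta>\<bar> powr (r - 1)"
    using \<xi> \<zeta> lo hi by (intro H) auto
  also have "\<dots> \<le> L * (hi - lo) powr (r - 1)"
    using \<xi> \<zeta> r L by (intro mult_left_mono powr_mono2) auto
  finally show ?thesis using \<xi> \<zeta> by simp
qed

lemma knot_powr: "0 < K \<Longrightarrow> (1 / real K) * (1 / real K) powr (r - 1) = real K powr (- r)"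
proof -
  assume K: "0 < K"
  have "(1 / real K) * (1 / real K) powr (r - 1) = (1 / real K) powr 1 * (1 / real K) powr (r - 1)" using K by simp
  also have "\<dots> = (1 / real K) powr r" by (simp only: powr_add[symmetric]) simp
  also have "\<dots> = real K powr (- r)" by (simp add: powr_divide powr_minus_divide)
  finally show ?thesis .
qed

lemma convex_holder_diff2:
  assumes f: "f \<in> convex_holder r L" and r: "1 < r" "r \<le> 2" and L: "0 < L" and k: "k \<in> {1..<K}"
  defines "a \<equiv> \<lambda>k. f (real k / real K)"
  shows "0 \<le> diff2 a k" and "diff2 a k \<le> 2 * L * real K powr (- r)"
proof -
  define x where "x = real k / real K"
  define h where "h = 1 / real K"
  have h0: "0 < h" using k by (simp add: h_def)
  have "real k + 1 \<le> real K" "1 \<le> real k" using k by (simp_all flip: of_nat_Suc)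
  then have x: "0 \<le> x - h" "x + h \<le> 1" using k by (simp_all add: x_def h_def field_simps)
  have a: "a (k - 1) = f (x - h)" "a k = f x" "a (k + 1) = f (x + h)"
    using k by (auto simp: a_def x_def h_def of_nat_diff diff_divide_distrib add_divide_distrib add.commute)
  have "f ((1 - 1/2) *\<^sub>R (x - h) + (1/2) *\<^sub>R (x + h)) \<le> (1 - 1/2) * f (x - h) + (1/2) * f (x + h)"
    using f x h0 by (intro convex_onD[of "{0..1}"]) (auto simp: convex_holder_def)
  moreover have "(1 - 1/2) *\<^sub>R (x - h) + (1/2) *\<^sub>R (x + h) = x" by (simp add: field_simps)
  ultimately show "0 \<le> diff2 a k" unfolding diff2_def a by simp
  have "\<bar>(f (x + h) - f x) / ((x + h) - x) - (f x - f (x - h)) / (x - (x - h))\<bar> \<le> L * ((x + h) - (x - h)) powr (r - 1)"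
    by (rule convex_holder_slopes[OF f r(1) L x]) (use h0 in auto)
  then have "(f (x + h) - 2 * f x + f (x - h)) / h \<le> L * (2 * h) powr (r - 1)"
    by (simp add: diff_divide_distrib add_divide_distrib abs_le_iff)
  also have "\<dots> = L * (2 powr (r - 1) * h powr (r - 1))" using h0 by (simp add: powr_mult)
  \<comment> \<open>The two adjacent chords span an interval of length \<open>2 h\<close>;
    \<open>r \<le> 2\<close> turns \<open>2 powr (r - 1)\<close> into the constant
    \<open>2\<close>.\<close>
  also have "\<dots> \<le> L * (2 powr 1 * h powr (r - 1))" using L r by (intro mult_left_mono mult_right_mono powr_mono) auto
  finally have "f (x + h) - 2 * f x + f (x - h) \<le> 2 * L * (h * h powr (r - 1))"
    using h0 by (simp add: field_simps)
  also have "h * h powr (r - 1) = real K powr (- r)" unfolding h_def using k by (intro knot_powr) auto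
  finally show "diff2 a k \<le> 2 * L * real K powr (- r)" unfolding diff2_def a by simp
qed

lemma convex_holder_interpolation:
  assumes f: "f \<in> convex_holder r L" and r: "1 < r" and L: "0 < L" and K: "0 < K" and x: "x \<in> {0..1}"
  shows "\<bar>pl K (\<lambda>k. f (real k / real K)) (real K * x) - f x\<bar> \<le> L * real K powr (- r)"
proof -
  obtain j where j: "j < K" "real j \<le> real K * x" "real K * x \<le> real j + 1"
    using unit_cell[of 0 K "real K * x"] K x by (auto simp: mult_left_le)
  define u where "u = real j / real K"
  define h where "h = 1 / real K"
  define \<theta> where "\<theta> = real K * x - real j"
  have h0: "0 < h" using K by (simp add: h_def)
  have \<theta>: "0 \<le> \<theta>" "\<theta> \<le> 1" using j by (auto simp: \<theta>_def)
  have xu: "x = u + \<theta> * h" using K by (simp add: \<theta>_def u_def h_def field_simps)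
  have "real j + 1 \<le> real K" using j by (simp flip: of_nat_Suc)
  then have u: "0 \<le> u" "u + h \<le> 1" using K by (simp_all add: u_def h_def field_simps)
  have uh: "f (real (j + 1) / real K) = f (u + h)" by (simp add: u_def h_def add_divide_distrib add.commute)
  have p: "pl K (\<lambda>k. f (real k / real K)) (real K * x) = (1 - \<theta>) * f u + \<theta> * f (u + h)"
    using pl_cell[OF j, of "\<lambda>k. f (real k / real K)"] unfolding uh by (simp add: \<theta>_def u_def)
  show ?thesis
  proof (cases "\<theta> = 0")
    case True
    then show ?thesis unfolding p using L xu by simp
  next
    case False
    then have t0: "0 < \<theta>" using \<theta> by simp
    have th: "0 < \<theta> * h" "\<theta> * h \<le> h" using t0 h0 \<theta> by (auto simp: mult_le_cancel_right1)
    have "\<bar>(f (u + h) - f u) / ((u + h) - u) - (f x - f u) / (x - u)\<bar> \<le> L * ((u + h) - u) powr (r - 1)"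
      by (rule convex_holder_slopes[OF f r L u]) (use h0 th xu in auto)
    then have b: "\<bar>(f (u + h) - f u) / h - (f x - f u) / (\<theta> * h)\<bar> \<le> L * h powr (r - 1)"
      by (simp add: xu)
    \<comment> \<open>The interpolation error is the distance from \<open>u\<close> to
      \<open>x\<close> times the difference between the slope over the whole cell and the slope up
      to \<open>x\<close>.\<close>
    have "(1 - \<theta>) * f u + \<theta> * f (u + h) - f x = \<theta> * h * ((f (u + h) - f u) / h - (f x - f u) / (\<theta> * h))"
      using t0 h0 by (simp add: field_simps)
    then have "\<bar>(1 - \<theta>) * f u + \<theta> * f (u + h) - f x\<bar> = \<theta> * h * \<bar>(f (u + h) - f u) / h - (f x - f u) / (\<theta> * h)\<bar>"
      using th by (simp only: abs_mult[of "\<theta> * h"] abs_of_pos)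
    also have "\<dots> \<le> h * (L * h powr (r - 1))" using b th h0 by (intro mult_mono) auto
    also have "\<dots> = L * (h * h powr (r - 1))" by simp
    also have "h * h powr (r - 1) = real K powr (- r)" unfolding h_def using K by (intro knot_powr) auto
    finally show ?thesis unfolding p .
  qed
qed

lemma convex_holder_continuous: "f \<in> convex_holder r L \<Longrightarrow> continuous_on {0..1} f"
  unfolding convex_holder_def using DERIV_continuous_on by blast

section \<open>Measurability of the uniform error\<close>

text \<open>For countable \<open>T\<close> this replaces the uncountable supremum by one that
  preserves measurability.\<close>

lemma sup_norm_dense:
  assumes T: "T \<subseteq> {0..1}" "{0..1} \<subseteq> closure T" and g: "continuous_on {0..1} g"
  shows "sup_norm g = (SUP x\<in>T. ennreal \<bar>g x\<bar>)"
proof (rule antisym)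
  show "(SUP x\<in>T. ennreal \<bar>g x\<bar>) \<le> sup_norm g"
    unfolding sup_norm_def using T by (intro SUP_subset_mono) auto
  show "sup_norm g \<le> (SUP x\<in>T. ennreal \<bar>g x\<bar>)"
    unfolding sup_norm_def
  proof (rule SUP_least)
    fix x :: real assume x: "x \<in> {0..1}"
    then obtain s where s: "\<And>n. s n \<in> T" "s \<longlonglongrightarrow> x" using T closure_sequential by blast
    have "(\<lambda>n. g (s n)) \<longlonglongrightarrow> g x"
      by (rule continuous_on_tendsto_compose[OF g s(2) x]) (use s(1) T(1) in \<open>intro always_eventually allI, blast\<close>)
    then have "(\<lambda>n. ennreal \<bar>g (s n)\<bar>) \<longlonglongrightarrow> ennreal \<bar>g x\<bar>"
      by (intro tendsto_intros)
    then show "ennreal \<bar>g x\<bar> \<le> (SUP x\<in>T. ennreal \<bar>g x\<bar>)"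
      by (rule LIMSEQ_le_const2) (use s(1) in \<open>auto intro!: SUP_upper\<close>)
  qed
qed

lemma sup_norm_measurable:
  assumes g: "\<And>\<omega>. continuous_on {0..1} (g \<omega>)" and m: "\<And>x. x \<in> {0..1} \<Longrightarrow> (\<lambda>\<omega>. g \<omega> x) \<in> borel_measurable M"
  shows "(\<lambda>\<omega>. sup_norm (g \<omega>)) \<in> borel_measurable M"
proof -
  obtain T :: "real set" where T: "countable T" "T \<subseteq> {0..1}" "{0..1} \<subseteq> closure T" using separable by blast
  show ?thesis
    unfolding sup_norm_dense[OF T(2,3) g]
  proof (rule borel_measurable_SUP[OF T(1)])
    fix x assume "x \<in> T"
    then have [measurable]: "(\<lambda>\<omega>. g \<omega> x) \<in> borel_measurable M" using T m by auto
    show "(\<lambda>\<omega>. ennreal \<bar>g \<omega> x\<bar>) \<in> borel_measurable M" by measurable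
  qed
qed

lemma sup_norm_le: "(\<And>x. x \<in> {0..1} \<Longrightarrow> \<bar>g x\<bar> \<le> B) \<Longrightarrow> sup_norm g \<le> ennreal B"
  unfolding sup_norm_def by (intro SUP_least ennreal_leI) auto

lemma measurable_of_Lipschitz_coords:
  fixes \<Phi> :: "(nat \<Rightarrow> real) \<Rightarrow> real"
  assumes eps: "\<And>i. i \<in> {1..n} \<Longrightarrow> eps i \<in> borel_measurable M"
    and Lip: "\<And>e e'. \<bar>\<Phi> e - \<Phi> e'\<bar> \<le> B * (\<Sum>i=1..n. \<bar>e i - e' i\<bar>)"
  shows "(\<lambda>\<omega>. \<Phi> (\<lambda>i. eps i \<omega>)) \<in> borel_measurable M"
proof -
  have "isCont \<Phi> e" for e
  proof -
    have "((\<lambda>e'. \<Phi> e' - \<Phi> e) \<longlongrightarrow> 0) (at e)"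
    proof (rule Lim_null_comparison)
      show "\<forall>\<^sub>F e' in at e. norm (\<Phi> e' - \<Phi> e) \<le> B * (\<Sum>i=1..n. \<bar>e' i - e i\<bar>)"
        using Lip by simp
      have "continuous_on UNIV (\<lambda>e'::nat \<Rightarrow> real. e' i)" for i by simp
      then have "((\<lambda>e'. e' i) \<longlongrightarrow> e i) (at e)" for i by (simp add: continuous_on_def)
      then have "((\<lambda>e'. B * (\<Sum>i=1..n. \<bar>e' i - e i\<bar>)) \<longlongrightarrow> B * (\<Sum>i=1..n. \<bar>e i - e i\<bar>)) (at e)"
        by (intro tendsto_intros)
      then show "((\<lambda>e'. B * (\<Sum>i=1..n. \<bar>e' i - e i\<bar>)) \<longlongrightarrow> 0) (at e)" by simp
    qed
    then show ?thesis unfolding isCont_def by (rule LIM_zero_cancel)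
  qed
  then have "continuous_on UNIV \<Phi>" by (simp add: continuous_on_eq_continuous_at)
  then have m: "\<Phi> \<in> borel_measurable borel" by (rule borel_measurable_continuous_onI)
  \<comment> \<open>Nothing is known about \<open>eps i\<close> outside \<open>{1..n}\<close>. Zeros
    there make the whole sequence measurable, and the Lipschitz bound shows that \<Phi> does not see
    the change.\<close>
  define e where "e = (\<lambda>\<omega> i. if i \<in> {1..n} then eps i \<omega> else 0)"
  have "e \<in> borel_measurable M"
  proof (rule measurable_coordinatewise_then_product)
    fix i show "(\<lambda>\<omega>. e \<omega> i) \<in> borel_measurable M"
      using eps by (cases "i \<in> {1..n}") (auto simp: e_def)
  qed
  then have "(\<lambda>\<omega>. \<Phi> (e \<omega>)) \<in> borel_measurable M" using m by (rule measurable_compose)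
  moreover have "\<Phi> (e \<omega>) = \<Phi> (\<lambda>i. eps i \<omega>)" for \<omega>
    using Lip[of "e \<omega>" "\<lambda>i. eps i \<omega>"] by (simp add: e_def)
  ultimately show ?thesis by simp
qed

section \<open>Gaussian noise\<close>

text \<open>Completing the square; the moment generating function thereby becomes the total mass of
  a normal density centred at \<open>t\<close>.\<close>

lemma std_normal_density_tilt:
  "std_normal_density x * exp (t * x) = exp (t\<^sup>2 / 2) * normal_density t 1 x"
proof -
  have "- x\<^sup>2 / 2 + t * x = t\<^sup>2 / 2 + - (x - t)\<^sup>2 / 2"
    by (simp add: power2_eq_square field_simps)
  then have "exp (- x\<^sup>2 / 2) * exp (t * x) = exp (t\<^sup>2 / 2) * exp (- (x - t)\<^sup>2 / 2)"
    by (simp only: exp_add[symmetric])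
  then show ?thesis by (simp add: normal_density_def)
qed

lemma std_normal_mgf:
  assumes X: "distributed M lborel X (\<lambda>x. ennreal (std_normal_density x))"
  shows "(\<integral>\<^sup>+\<omega>. ennreal (exp (t * X \<omega>)) \<partial>M) = ennreal (exp (t\<^sup>2 / 2))"
proof -
  have "(\<integral>\<^sup>+\<omega>. ennreal (exp (t * X \<omega>)) \<partial>M)
      = (\<integral>\<^sup>+x. ennreal (std_normal_density x) * ennreal (exp (t * x)) \<partial>lborel)"
    by (rule distributed_nn_integral[OF X, symmetric]) measurable
  also have "\<dots> = (\<integral>\<^sup>+x. ennreal (exp (t\<^sup>2 / 2)) * ennreal (normal_density t 1 x) \<partial>lborel)"
    by (simp add: ennreal_mult[symmetric] std_normal_density_tilt)
  also have "\<dots> = ennreal (exp (t\<^sup>2 / 2)) * (\<integral>\<^sup>+x. ennreal (normal_density t 1 x) \<partial>lborel)"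
    by (rule nn_integral_cmult) measurable
  also have "(\<integral>\<^sup>+x. ennreal (normal_density t 1 x) \<partial>lborel) = ennreal 1"
    by (subst nn_integral_eq_integral) auto
  finally show ?thesis by simp
qed

lemma std_normal_errors_measurable:
  assumes "std_normal_errors M n eps" "i \<in> {1..n}"
  shows "eps i \<in> borel_measurable M"
  using assms distributed_measurable[of M lborel "eps i" "\<lambda>x. ennreal (std_normal_density x)"]
  by (auto simp: std_normal_errors_def)

lemma std_normal_errors_mgf:
  assumes M: "prob_space M" and e: "std_normal_errors M n eps"
  shows "(\<integral>\<^sup>+\<omega>. ennreal (exp (\<Sum>i=1..n. c i * eps i \<omega>)) \<partial>M) = ennreal (exp ((\<Sum>i=1..n. (c i)\<^sup>2) / 2))"
proof -
  interpret prob_space M by fact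
  have ind: "indep_vars (\<lambda>_. borel) eps {1..n}"
    and d: "\<And>i. i \<in> {1..n} \<Longrightarrow> distributed M lborel (eps i) (\<lambda>x. ennreal (std_normal_density x))"
    using e by (auto simp: std_normal_errors_def)
  have "indep_vars (\<lambda>_. borel) (\<lambda>i \<omega>. ennreal (exp (c i * eps i \<omega>))) {1..n}"
    by (rule indep_vars_compose2[OF ind]) measurable
  note prod = indep_vars_nn_integral[OF finite_atLeastAtMost this zero_le]
  have "(\<integral>\<^sup>+\<omega>. ennreal (exp (\<Sum>i=1..n. c i * eps i \<omega>)) \<partial>M)
      = (\<integral>\<^sup>+\<omega>. (\<Prod>i\<in>{1..n}. ennreal (exp (c i * eps i \<omega>))) \<partial>M)"
    by (simp add: exp_sum prod_ennreal)
  also have "\<dots> = (\<Prod>i\<in>{1..n}. \<integral>\<^sup>+\<omega>. ennreal (exp (c i * eps i \<omega>)) \<partial>M)" by (rule prod)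
  also have "\<dots> = (\<Prod>i\<in>{1..n}. ennreal (exp ((c i)\<^sup>2 / 2)))"
    using std_normal_mgf[OF d] by (intro prod.cong) auto
  also have "\<dots> = ennreal (exp ((\<Sum>i=1..n. (c i)\<^sup>2) / 2))"
    by (simp add: prod_ennreal exp_sum sum_divide_distrib)
  finally show ?thesis .
qed

text \<open>
  \<open>Z\<close> is not the maximum itself but the majorant given by
  \<open>s w \<le> ln A + exp (s w) / A - 1\<close>, with all exponentials summed up.
\<close>

lemma noise_bound:
  assumes M: "prob_space M" and e: "std_normal_errors M (K * m) eps" and K: "0 < K" "0 < m" and s: "0 < s"
  obtains Z where "Z \<in> borel_measurable M"
    "\<And>\<omega> k. k \<le> K \<Longrightarrow> \<bar>\<Sum>i=1..K*m. tent m k i * eps i \<omega>\<bar> \<le> Z \<omega>"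
    "(\<integral>\<^sup>+\<omega>. ennreal (Z \<omega>) \<partial>M) \<le> ennreal ((ln (2 * (real K + 1)) + s\<^sup>2 * real m / 2 + 1) / s)"
proof -
  interpret prob_space M by fact
  define W where "W = (\<lambda>k \<omega>. \<Sum>i=1..K*m. tent m k i * eps i \<omega>)"
  \<comment> \<open>\<open>A\<close> bounds the expectation of \<open>E\<close>: two signs for each
    of \<open>K + 1\<close> sums of variance at most \<open>m\<close>. Hence \<open>E / A\<close>
    has expectation at most \<open>1\<close>, the last summand of the claimed numerator.\<close>
  define A where "A = 2 * (real K + 1) * exp (s\<^sup>2 * real m / 2)"
  define E where "E = (\<lambda>\<omega>. \<Sum>k\<le>K. exp (s * W k \<omega>) + exp (- s * W k \<omega>))"
  define Z where "Z = (\<lambda>\<omega>. ln A / s + 1 / (s * A) * E \<omega>)"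
  have A1: "1 \<le> A"
    using mult_mono[of 1 "2 * (real K + 1)" 1 "exp (s\<^sup>2 * real m / 2)"] by (simp add: A_def)
  have lnA: "ln A = ln (2 * (real K + 1)) + s\<^sup>2 * real m / 2"
    unfolding A_def by (subst ln_mult) auto
  have E0: "0 \<le> E \<omega>" for \<omega> unfolding E_def by (intro sum_nonneg add_nonneg_nonneg) auto
  have [measurable]: "W k \<in> borel_measurable M" for k
    unfolding W_def using std_normal_errors_measurable[OF e] by (intro borel_measurable_sum) auto
  have [measurable]: "E \<in> borel_measurable M" unfolding E_def by measurable
  show ?thesis
  proof
    show "Z \<in> borel_measurable M" unfolding Z_def by measurable
    show "\<bar>\<Sum>i=1..K*m. tent m k i * eps i \<omega>\<bar> \<le> Z \<omega>" if k: "k \<le> K" for \<omega> k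
    proof -
      let ?w = "\<bar>W k \<omega>\<bar>"
      have "exp (s * ?w) \<le> exp (s * W k \<omega>) + exp (- s * W k \<omega>)"
        by (cases "0 \<le> W k \<omega>") (auto simp: add_increasing add_increasing2)
      also have "\<dots> \<le> E \<omega>" unfolding E_def using k by (intro member_le_sum) auto
      finally have "exp (s * ?w) / A \<le> E \<omega> / A" using A1 by (intro divide_right_mono) auto
      moreover have "ln (exp (s * ?w) / A) \<le> exp (s * ?w) / A - 1" using A1 by (intro ln_le_minus_one) auto
      moreover have "ln (exp (s * ?w) / A) = s * ?w - ln A" using A1 by (subst ln_div) auto
      ultimately have "s * ?w \<le> ln A + E \<omega> / A" by linarith
      then have "?w \<le> (ln A + E \<omega> / A) / s" using s by (simp add: pos_le_divide_eq mult.commute)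
      also have "\<dots> = Z \<omega>" by (simp add: Z_def add_divide_distrib mult.commute)
      finally show ?thesis by (simp add: W_def)
    qed
    have mgf: "(\<integral>\<^sup>+\<omega>. ennreal (exp (t * W k \<omega>)) \<partial>M) \<le> ennreal (exp (s\<^sup>2 * real m / 2))"
      if "k \<le> K" "\<bar>t\<bar> = s" for k t
    proof -
      have "t * W k \<omega> = (\<Sum>i=1..K*m. (t * tent m k i) * eps i \<omega>)" for \<omega>
        by (simp add: W_def sum_distrib_left mult.assoc)
      then have "(\<integral>\<^sup>+\<omega>. ennreal (exp (t * W k \<omega>)) \<partial>M) = ennreal (exp ((\<Sum>i=1..K*m. (t * tent m k i)\<^sup>2) / 2))"
        using std_normal_errors_mgf[OF M e, of "\<lambda>i. t * tent m k i"] by simp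
      also have "(\<Sum>i=1..K*m. (t * tent m k i)\<^sup>2) = s\<^sup>2 * (\<Sum>i=1..K*m. (tent m k i)\<^sup>2)"
        using that by (auto simp: power_mult_distrib sum_distrib_left)
      also have "ennreal (exp (s\<^sup>2 * (\<Sum>i=1..K*m. (tent m k i)\<^sup>2) / 2)) \<le> ennreal (exp (s\<^sup>2 * real m / 2))"
        using tent_square_sum_le[OF K(1) that(1) K(2)] by (intro ennreal_leI) (simp add: mult_left_mono)
      finally show ?thesis .
    qed
    have "(\<integral>\<^sup>+\<omega>. ennreal (E \<omega>) \<partial>M)
        = (\<integral>\<^sup>+\<omega>. (\<Sum>k\<le>K. ennreal (exp (s * W k \<omega>)) + ennreal (exp (- s * W k \<omega>))) \<partial>M)"
      unfolding E_def by (simp add: sum_ennreal[symmetric] ennreal_plus)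
    also have "\<dots> = (\<Sum>k\<le>K. (\<integral>\<^sup>+\<omega>. ennreal (exp (s * W k \<omega>)) \<partial>M) + (\<integral>\<^sup>+\<omega>. ennreal (exp (- s * W k \<omega>)) \<partial>M))"
      by (subst nn_integral_sum, measurable) (intro sum.cong refl nn_integral_add, measurable)
    also have "\<dots> \<le> (\<Sum>k\<le>K. ennreal (exp (s\<^sup>2 * real m / 2)) + ennreal (exp (s\<^sup>2 * real m / 2)))"
      using s by (intro sum_mono add_mono mgf) auto
    also have "\<dots> = ennreal (\<Sum>k\<le>K. exp (s\<^sup>2 * real m / 2) + exp (s\<^sup>2 * real m / 2))"
      by (subst sum_ennreal[symmetric]) (simp_all only: ennreal_plus exp_ge_zero add_nonneg_nonneg)
    also have "\<dots> = ennreal A" by (simp add: A_def algebra_simps)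
    finally have EE: "(\<integral>\<^sup>+\<omega>. ennreal (E \<omega>) \<partial>M) \<le> ennreal A" .
    have "(\<integral>\<^sup>+\<omega>. ennreal (Z \<omega>) \<partial>M) = (\<integral>\<^sup>+\<omega>. ennreal (ln A / s) + ennreal (1 / (s * A)) * ennreal (E \<omega>) \<partial>M)"
      unfolding Z_def using s A1 E0 by (intro nn_integral_cong) (simp add: ennreal_plus ennreal_mult[symmetric])
    also have "\<dots> = ennreal (ln A / s) + ennreal (1 / (s * A)) * (\<integral>\<^sup>+\<omega>. ennreal (E \<omega>) \<partial>M)"
      by (simp add: nn_integral_add nn_integral_cmult emeasure_space_1)
    also have "\<dots> \<le> ennreal (ln A / s) + ennreal (1 / (s * A)) * ennreal A"
      by (intro add_left_mono mult_left_mono EE) auto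
    also have "\<dots> = ennreal (ln A / s + 1 / (s * A) * A)"
      using s A1 by (simp add: ennreal_plus ennreal_mult[symmetric])
    also have "ln A / s + 1 / (s * A) * A = (ln (2 * (real K + 1)) + s\<^sup>2 * real m / 2 + 1) / s"
      using s A1 by (simp add: lnA add_divide_distrib)
    finally show "(\<integral>\<^sup>+\<omega>. ennreal (Z \<omega>) \<partial>M) \<le> ennreal ((ln (2 * (real K + 1)) + s\<^sup>2 * real m / 2 + 1) / s)" .
  qed
qed

section \<open>Rate of convergence\<close>

lemma observations_nth:
  "i \<in> {1..n} \<Longrightarrow> observations n f \<sigma> e $ (i - 1) = f (design_pt n i) + \<sigma> * e i"
  by (cases i) (auto simp: observations_def)

lemma observations_dim: "observations n f \<sigma> e \<in> carrier_vec n"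
  by (simp add: observations_def)

lemma penalty_bounds:
  assumes "2 \<le> K" "0 < m"
  shows "0 \<le> penalty_param (K * m) K" "penalty_param (K * m) K \<le> real m / real K"
  using beta_pos[OF assms] beta_le[OF assms] assms
  by (auto simp: penalty_param_def divide_inverse intro!: mult_right_mono)

lemma coeff_estimator_stationary:
  assumes "2 \<le> K" "2 \<le> m"
  shows "stationary K m (penalty_param (K * m) K) (\<lambda>i. observations (K * m) f \<sigma> e $ (i - 1))
     (($) (coeff_estimator (K * m) K (penalty_param (K * m) K) (observations (K * m) f \<sigma> e)))"
  by (intro minimizer_stationary coeff_estimator_minimizer observations_dim penalty_bounds) (use assms in auto)

lemma pl_diff_le:
  assumes "0 < K" "0 \<le> z" "z \<le> real K" and B: "\<And>k. k \<le> K \<Longrightarrow> \<bar>b k - a k\<bar> \<le> B"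
  shows "\<bar>pl K b z - pl K a z\<bar> \<le> B"
proof -
  have "pl K (\<lambda>k. b k - a k) z \<le> pl K (\<lambda>_. B) z" "pl K (\<lambda>_. - B) z \<le> pl K (\<lambda>k. b k - a k) z"
    by (rule pl_mono[of 0 K]; use assms B in \<open>force simp: abs_le_iff\<close>)+
  then show ?thesis using pl_const[OF assms(1-3)] by (simp add: pl_diff abs_le_iff)
qed

text \<open>The constants are \<open>122 = 11 * (1 + 10) + 1\<close> and
  \<open>55 / 2 = 11 * 5 / 2\<close>. In the first, \<open>1\<close> is the bias at the design
  points, \<open>10\<close> the penalty with curvature bound \<open>2 * L * K powr (- r)\<close>,
  and the final \<open>1\<close> the interpolation error at \<open>x\<close>.\<close>

lemma estimator_error:
  assumes r: "1 < r" "r \<le> 2" and L: "0 < L" and \<sigma>: "0 < \<sigma>" and f: "f \<in> convex_holder r L"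
    and K: "100 \<le> K" and m: "5 \<le> m"
    and Z: "\<And>k. k \<le> K \<Longrightarrow> \<bar>\<Sum>i=1..K*m. tent m k i * e i\<bar> \<le> Z"
    and x: "x \<in> {0..1}"
  shows "\<bar>pspline_estimator (K * m) K (penalty_param (K * m) K) (observations (K * m) f \<sigma> e) x - f x\<bar>
     \<le> 122 * L * real K powr (- r) + 55 / 2 * \<sigma> / real m * Z"
proof -
  let ?b = "($) (coeff_estimator (K * m) K (penalty_param (K * m) K) (observations (K * m) f \<sigma> e))"
  let ?y = "\<lambda>i. observations (K * m) f \<sigma> e $ (i - 1)"
  define a where "a = (\<lambda>k. f (real k / real K))"
  define \<rho> where "\<rho> = real K powr (- r)"
  have K': "2 \<le> K" "0 < K" "2 \<le> m" "0 < m" using K m by auto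
  have \<rho>0: "0 \<le> \<rho>" by (simp add: \<rho>_def)
  have "\<bar>?b k - a k\<bar> \<le> 11 * (L * \<rho> + 5 / 2 * (\<sigma> * Z) / real m + 5 * (2 * L * \<rho>) / real K)" if "k \<le> K" for k
  proof (rule uniform_stability[OF K m penalty_bounds[OF K'(1,4)] coeff_estimator_stationary[OF K'(1,3)] _ _ _ _ _ that,
        where a = a and g = "\<lambda>i. f (design_pt (K * m) i) - pl K a (real i / real m)" and e = "\<lambda>i. \<sigma> * e i"])
    fix k assume "k \<in> {1..<K}"
    then show "0 \<le> diff2 a k \<and> diff2 a k \<le> 2 * L * \<rho>"
      unfolding a_def \<rho>_def using convex_holder_diff2[OF f r L] by blast
  next
    show "0 \<le> 2 * L * \<rho>" using L \<rho>0 by simp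
  next
    fix i assume i: "i \<in> {1..K*m}"
    then show "?y i = pl K a (real i / real m) + (f (design_pt (K * m) i) - pl K a (real i / real m)) + \<sigma> * e i"
      by (simp only: observations_nth)
    have "real K * design_pt (K * m) i = real i / real m" using K' by (simp add: design_pt_def)
    moreover have "design_pt (K * m) i \<in> {0..1}"
      using i by (auto simp: design_pt_def divide_le_eq_1 simp flip: of_nat_mult)
    ultimately show "\<bar>f (design_pt (K * m) i) - pl K a (real i / real m)\<bar> \<le> L * \<rho>"
      using convex_holder_interpolation[OF f r(1) L K'(2), of "design_pt (K * m) i"]
      by (simp add: a_def \<rho>_def abs_minus_commute)
  next
    fix k assume "k \<le> K"
    have "(\<Sum>i=1..K*m. tent m k i * (\<sigma> * e i)) = \<sigma> * (\<Sum>i=1..K*m. tent m k i * e i)"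
      by (simp add: sum_distrib_left algebra_simps)
    then show "\<bar>\<Sum>i=1..K*m. tent m k i * (\<sigma> * e i)\<bar> \<le> \<sigma> * Z"
      using Z[OF \<open>k \<le> K\<close>] \<sigma> by (simp add: abs_mult)
  qed
  moreover have "0 \<le> L * \<rho>" using L \<rho>0 by simp
  then have "5 * (2 * L * \<rho>) / real K \<le> 10 * (L * \<rho>)"
    using K by (simp add: divide_le_eq mult_le_cancel_left1)
  ultimately have "\<bar>?b k - a k\<bar> \<le> 121 * (L * \<rho>) + 55 / 2 * \<sigma> / real m * Z" if "k \<le> K" for k
    using that by fastforce
  then have "\<bar>pl K ?b (real K * x) - pl K a (real K * x)\<bar> \<le> 121 * (L * \<rho>) + 55 / 2 * \<sigma> / real m * Z"
    using x by (intro pl_diff_le[OF K'(2)]) (auto simp: mult_left_le)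
  moreover have "\<bar>pl K a (real K * x) - f x\<bar> \<le> L * \<rho>"
    unfolding a_def \<rho>_def by (rule convex_holder_interpolation[OF f r(1) L K'(2) x])
  ultimately show ?thesis unfolding pspline_estimator_pl \<rho>_def[symmetric] by (simp add: abs_le_iff)
qed

text \<open>For fixed \<open>x\<close> the estimate is a finite combination of coefficients that are
  Lipschitz in the errors; continuity in \<open>x\<close> passes measurability on to the
  supremum.\<close>

lemma sup_norm_error_measurable:
  assumes f: "f \<in> convex_holder r L" and K: "2 \<le> K" "2 \<le> m"
    and e: "std_normal_errors M (K * m) eps"
  shows "(\<lambda>\<omega>. sup_norm (\<lambda>x. pspline_estimator (K * m) K (penalty_param (K * m) K)
            (observations (K * m) f \<sigma> (\<lambda>i. eps i \<omega>)) x - f x)) \<in> borel_measurable M"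
proof (rule sup_norm_measurable)
  fix \<omega>
  show "continuous_on {0..1} (\<lambda>x. pspline_estimator (K * m) K (penalty_param (K * m) K)
            (observations (K * m) f \<sigma> (\<lambda>i. eps i \<omega>)) x - f x)"
    unfolding pspline_estimator_pl pl_def
    by (intro continuous_intros convex_holder_continuous[OF f])
next
  let ?c = "\<lambda>e. coeff_estimator (K * m) K (penalty_param (K * m) K) (observations (K * m) f \<sigma> e)"
  fix x :: real
  have K': "0 < K" "0 < m" using K by auto
  have [measurable]: "(\<lambda>\<omega>. ?c (\<lambda>i. eps i \<omega>) $ k) \<in> borel_measurable M" if k: "k \<le> K" for k
  proof (rule measurable_of_Lipschitz_coords[where \<Phi> = "\<lambda>e. ?c e $ k" and B = "3 * \<bar>\<sigma>\<bar>"])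
    show "eps i \<in> borel_measurable M" if "i \<in> {1..K*m}" for i
      by (rule std_normal_errors_measurable[OF e that])
    fix e e' :: "nat \<Rightarrow> real"
    have "\<bar>?c e $ k - ?c e' $ k\<bar> \<le> 3 * (\<Sum>i=1..K*m. \<bar>observations (K * m) f \<sigma> e $ (i - 1) - observations (K * m) f \<sigma> e' $ (i - 1)\<bar>)"
      by (rule stationary_Lipschitz[OF K'(1) K(2) penalty_bounds(1)[OF K(1) K'(2)]
          coeff_estimator_stationary[OF K] coeff_estimator_stationary[OF K] k])
    also have "\<dots> = 3 * (\<Sum>i=1..K*m. \<bar>\<sigma>\<bar> * \<bar>e i - e' i\<bar>)"
      by (intro arg_cong[where f = "(*) 3"] sum.cong refl)
        (simp only: observations_nth abs_mult[symmetric], simp add: algebra_simps)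
    finally show "\<bar>?c e $ k - ?c e' $ k\<bar> \<le> 3 * \<bar>\<sigma>\<bar> * (\<Sum>i=1..K*m. \<bar>e i - e' i\<bar>)"
      by (simp add: sum_distrib_left mult.assoc)
  qed
  show "(\<lambda>\<omega>. pspline_estimator (K * m) K (penalty_param (K * m) K)
            (observations (K * m) f \<sigma> (\<lambda>i. eps i \<omega>)) x - f x) \<in> borel_measurable M"
    unfolding pspline_estimator_pl pl_def
    by (intro borel_measurable_diff borel_measurable_sum borel_measurable_times) auto
qed

text \<open>The second condition gives \<open>K \<ge> 100\<close>. The third gives
  \<open>m \<ge> 5\<close>, as rounding up increases the number of knots by at most
  \<open>1\<close>. The first lets additive constants be absorbed into the logarithm.\<close>

lemma eventually_regime:
  assumes r: "1 < r"
  shows "\<forall>\<^sub>F n in sequentially. 1 \<le> ln (real n) \<and>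
     100 \<le> (real n / ln (real n)) powr (1 / (2 * r + 1)) \<and>
     5 * ((real n / ln (real n)) powr (1 / (2 * r + 1)) + 1) \<le> real n"
proof -
  define q where "q = 1 / (2 * r + 1)"
  have q: "0 < q" "q < 1" using r by (auto simp: q_def)
  have "\<forall>\<^sub>F n in sequentially. 1 \<le> ln (real n)" by real_asymp
  moreover have "filterlim (\<lambda>n. (real n / ln (real n)) powr q) at_top sequentially"
    using q by real_asymp
  then have "\<forall>\<^sub>F n in sequentially. 100 \<le> (real n / ln (real n)) powr q"
    by (simp add: filterlim_at_top)
  moreover have "\<forall>\<^sub>F n in sequentially. 5 * ((real n / ln (real n)) powr q + 1) \<le> real n"
    using q by real_asymp
  ultimately show ?thesis unfolding q_def by eventually_elim auto
qed

lemma rate_bounds: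
  assumes r: "1 < r" and K: "K = num_knots r n" and n: "n = K * m"
    and reg: "1 \<le> ln (real n)" "100 \<le> (real n / ln (real n)) powr (1 / (2 * r + 1))"
     "5 * ((real n / ln (real n)) powr (1 / (2 * r + 1)) + 1) \<le> real n"
  defines "\<rho> \<equiv> (ln (real n) / real n) powr (r / (2 * r + 1))"
  shows "100 \<le> K" "5 \<le> m" "real K powr (- r) \<le> \<rho>" "sqrt (ln (real n) / real m) \<le> sqrt 2 * \<rho>"
    "2 * (real K + 1) \<le> real n"
proof -
  define N where "N = real n / ln (real n)"
  define q where "q = 1 / (2 * r + 1)"
  define \<kappa> where "\<kappa> = N powr q"
  have n0: "0 < n" using reg(1) by (cases "n = 0") auto
  have N0: "0 < N" unfolding N_def using n0 reg(1) by (intro divide_pos_pos of_nat_0_less_iff[THEN iffD2]) linarith+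
  \<comment> \<open>The identity \<open>q - 1 = - 2 * (r * q)\<close> is the balance behind the
    choice of \<open>K\<close>: with \<open>K\<close> of order \<open>N powr q\<close>, the squared
    noise level \<open>K / N\<close> and the squared bias \<open>K powr (- 2 * r)\<close> have the
    same order.\<close>
  have q: "0 < q" "r * q = r / (2 * r + 1)" "q - 1 = - 2 * (r * q)" using r by (auto simp: q_def field_simps)
  have \<kappa>: "100 \<le> \<kappa>" "5 * (\<kappa> + 1) \<le> real n" using reg by (auto simp: \<kappa>_def N_def q_def)
  have KK: "K = nat \<lceil>\<kappa>\<rceil>" using K by (simp add: num_knots_def \<kappa>_def N_def q_def)
  have Kb: "\<kappa> \<le> real K" "real K \<le> \<kappa> + 1" unfolding KK using \<kappa> by linarith+
  show K100: "100 \<le> K" using Kb \<kappa> by linarith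
  have nr: "real n = real K * real m" by (simp add: n)
  show m5: "5 \<le> m"
  proof -
    have "5 * real K \<le> 5 * (\<kappa> + 1)" using Kb by simp
    also have "\<dots> \<le> real n" by (rule \<kappa>(2))
    finally have "5 * real K \<le> real n" .
    then have "5 \<le> real m" using K100 unfolding nr by (simp add: mult.commute)
    then show ?thesis by simp
  qed
  have "ln (real n) / real n = N powr (- 1)" using n0 reg(1) by (simp add: N_def powr_minus_divide)
  then have \<rho>: "\<rho> = N powr (- (r * q))" unfolding \<rho>_def by (simp only: powr_powr q(2)) simp
  have "real K powr (- r) \<le> \<kappa> powr (- r)" using Kb \<kappa> r by (intro powr_mono2') auto
  also have "\<dots> = \<rho>" unfolding \<rho> \<kappa>_def by (simp add: powr_powr mult.commute)
  finally show "real K powr (- r) \<le> \<rho>" .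
  have "ln (real n) / real m = real K / N" using nr n0 by (simp add: N_def field_simps)
  also have "\<dots> \<le> 2 * \<kappa> / N" using Kb \<kappa> N0 by (intro divide_right_mono) auto
  also have "\<dots> = 2 * N powr (q - 1)" unfolding \<kappa>_def using N0 by (simp add: powr_diff)
  also have "\<dots> = 2 * \<rho>\<^sup>2" unfolding \<rho> q(3) by (simp add: power2_eq_square powr_add[symmetric] mult.commute)
  finally have "sqrt (ln (real n) / real m) \<le> sqrt (2 * \<rho>\<^sup>2)" by (rule real_sqrt_le_mono)
  then show "sqrt (ln (real n) / real m) \<le> sqrt 2 * \<rho>" by (simp add: real_sqrt_mult \<rho>_def)
  show "2 * (real K + 1) \<le> real n"
  proof -
    have "real K * 5 \<le> real n" unfolding nr using m5 by (intro mult_left_mono) auto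
    moreover have "2 * (real K + 1) \<le> real K * 5" using K100 by simp
    ultimately show ?thesis by simp
  qed
qed

theorem theorem4p2:
  fixes r L \<sigma> :: real
  assumes "1 < r" and "r \<le> 2" and "L > 0" and "\<sigma> > 0"
  shows "\<exists>C0>0. \<forall>\<^sub>F n in sequentially. \<forall>K lam_star.
           K = num_knots r n \<longrightarrow> lam_star = penalty_param n K \<longrightarrow> 2 \<le> K \<longrightarrow> K dvd n \<longrightarrow>
           (\<forall>(M :: 'a measure) eps. prob_space M \<longrightarrow> std_normal_errors M n eps \<longrightarrow>
              (\<forall>f\<in>convex_holder r L.
                 (\<lambda>\<omega>. sup_norm (\<lambda>x. pspline_estimator n K lam_star
                          (observations n f \<sigma> (\<lambda>i. eps i \<omega>)) x - f x)) \<in> borel_measurable M) \<and>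
              (SUP f\<in>convex_holder r L.
                 \<integral>\<^sup>+\<omega>. sup_norm (\<lambda>x. pspline_estimator n K lam_star
                          (observations n f \<sigma> (\<lambda>i. eps i \<omega>)) x - f x) \<partial>M)
                \<le> ennreal (C0 * (ln (real n) / real n) powr (r / (2 * r + 1))))"
\<comment> \<open>\<open>122\<close> is the constant of \<open>estimator_error\<close>. In
  \<open>110 = 55 / 2 * 4\<close> the \<open>4\<close> is an upper bound for
  \<open>5 / 2 * sqrt 2\<close>, the factor of \<rho> in the bound on
  \<open>\<zeta> / m\<close>.\<close>
proof (intro exI[of _ "122 * L + 110 * \<sigma>"] conjI)
  show "0 < 122 * L + 110 * \<sigma>" using assms by simp
  show "\<forall>\<^sub>F n in sequentially. \<forall>K lam_star.
           K = num_knots r n \<longrightarrow> lam_star = penalty_param n K \<longrightarrow> 2 \<le> K \<longrightarrow> K dvd n \<longrightarrow>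
           (\<forall>(M :: 'a measure) eps. prob_space M \<longrightarrow> std_normal_errors M n eps \<longrightarrow>
              (\<forall>f\<in>convex_holder r L.
                 (\<lambda>\<omega>. sup_norm (\<lambda>x. pspline_estimator n K lam_star
                          (observations n f \<sigma> (\<lambda>i. eps i \<omega>)) x - f x)) \<in> borel_measurable M) \<and>
              (SUP f\<in>convex_holder r L.
                 \<integral>\<^sup>+\<omega>. sup_norm (\<lambda>x. pspline_estimator n K lam_star
                          (observations n f \<sigma> (\<lambda>i. eps i \<omega>)) x - f x) \<partial>M)
                \<le> ennreal ((122 * L + 110 * \<sigma>) * (ln (real n) / real n) powr (r / (2 * r + 1))))"
    using eventually_regime[OF assms(1)]
  proof eventually_elim
    case (elim n)
    show ?case
    proof (intro allI impI)
      fix K lam_star and M :: "'a measure" and eps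
      assume K: "K = num_knots r n" and lam: "lam_star = penalty_param n K" and "2 \<le> K" and "K dvd n"
        and M: "prob_space M" and e: "std_normal_errors M n eps"
      then obtain m where n: "n = K * m" by (elim dvdE)
      define \<rho> where "\<rho> = (ln (real n) / real n) powr (r / (2 * r + 1))"
      note rates = rate_bounds[OF assms(1) K n, folded \<rho>_def]
      have K100: "100 \<le> K" and m5: "5 \<le> m" and \<rho>1: "real K powr (- r) \<le> \<rho>"
        and \<rho>2: "sqrt (ln (real n) / real m) \<le> sqrt 2 * \<rho>" and Kn: "2 * (real K + 1) \<le> real n"
        using rates elim by blast+
      have KK: "2 \<le> K" "0 < K" "2 \<le> m" "0 < m" using K100 m5 by auto
      interpret prob_space M by fact
      let ?err = "\<lambda>f \<omega>. sup_norm (\<lambda>x. pspline_estimator n K lam_star (observations n f \<sigma> (\<lambda>i. eps i \<omega>)) x - f x)"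
      \<comment> \<open>This choice balances the bound on the expectation of \<open>Z\<close>:
        \<open>s\<^sup>2 * m\<close> equals \<open>ln n\<close>, while
        \<open>ln (2 * (K + 1))\<close> and \<open>1\<close> are at most \<open>ln n\<close>. The
        numerator is then at most \<open>5 / 2 * ln n\<close>, and the quotient at most
        \<open>5 / 2 * s * m\<close>.\<close>
      define s where "s = sqrt (ln (real n) / real m)"
      have s0: "0 < s" using elim KK by (simp add: s_def)
      \<comment> \<open>\<open>Z\<close> is fixed before \<open>f\<close>, so the same majorant of
        the noise serves the whole class and the supremum over \<open>f\<close> costs
        nothing.\<close>
      obtain Z where Zm [measurable]: "Z \<in> borel_measurable M"
        and Z: "\<And>\<omega> k. k \<le> K \<Longrightarrow> \<bar>\<Sum>i=1..K*m. tent m k i * eps i \<omega>\<bar> \<le> Z \<omega>"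
        and EZ: "(\<integral>\<^sup>+\<omega>. ennreal (Z \<omega>) \<partial>M) \<le> ennreal ((ln (2 * (real K + 1)) + s\<^sup>2 * real m / 2 + 1) / s)"
      proof (rule noise_bound[OF M e[unfolded n] KK(2,4) s0])
        fix Z assume "Z \<in> borel_measurable M"
          "\<And>\<omega> k. k \<le> K \<Longrightarrow> \<bar>\<Sum>i=1..K*m. tent m k i * eps i \<omega>\<bar> \<le> Z \<omega>"
          "(\<integral>\<^sup>+\<omega>. ennreal (Z \<omega>) \<partial>M) \<le> ennreal ((ln (2 * (real K + 1)) + s\<^sup>2 * real m / 2 + 1) / s)"
        then show thesis by (rule that)
      qed
      have Z0: "0 \<le> Z \<omega>" for \<omega> using Z[of 0 \<omega>] by linarith
      define \<zeta> where "\<zeta> = (ln (2 * (real K + 1)) + s\<^sup>2 * real m / 2 + 1) / s"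
      have s2: "s\<^sup>2 * real m = ln (real n)" using elim KK by (simp add: s_def)
      have \<zeta>0: "0 \<le> \<zeta>" unfolding \<zeta>_def s2 using s0 elim by (intro divide_nonneg_pos add_nonneg_nonneg) auto
      have "ln (2 * (real K + 1)) \<le> ln (real n)" using Kn by (subst ln_le_cancel_iff) auto
      moreover have "1 \<le> ln (real n)" using elim by blast
      ultimately have "ln (2 * (real K + 1)) + ln (real n) / 2 + 1 \<le> 5 / 2 * ln (real n)" by linarith
      then have "\<zeta> \<le> (5 / 2 * (s\<^sup>2 * real m)) / s"
        unfolding \<zeta>_def s2 using s0 by (intro divide_right_mono) simp_all
      also have "\<dots> = 5 / 2 * s * real m" using s0 by (simp add: power2_eq_square)
      finally have "\<zeta> / real m \<le> 5 / 2 * s" using KK by (simp add: divide_le_eq)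
      also have "\<dots> \<le> 5 / 2 * (sqrt 2 * \<rho>)" using \<rho>2 by (simp add: s_def)
      also have "\<dots> \<le> 4 * \<rho>"
      proof -
        have "sqrt 2 \<le> 8 / 5" by (rule real_le_lsqrt) (auto simp: power2_eq_square)
        then have "sqrt 2 * \<rho> \<le> 8 / 5 * \<rho>" by (rule mult_right_mono) (simp add: \<rho>_def)
        then show ?thesis by simp
      qed
      finally have \<zeta>: "\<zeta> / real m \<le> 4 * \<rho>" .
      define \<alpha> where "\<alpha> = 122 * L * real K powr (- r)"
      define \<gamma> where "\<gamma> = 55 / 2 * \<sigma> / real m"
      have ag: "0 \<le> \<alpha>" "0 \<le> \<gamma>" using assms by (auto simp: \<alpha>_def \<gamma>_def)
      have bound: "(\<integral>\<^sup>+\<omega>. ?err f \<omega> \<partial>M) \<le> ennreal ((122 * L + 110 * \<sigma>) * \<rho>)" if f: "f \<in> convex_holder r L" for f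
      proof -
        have "(\<integral>\<^sup>+\<omega>. ?err f \<omega> \<partial>M) \<le> (\<integral>\<^sup>+\<omega>. ennreal \<alpha> + ennreal \<gamma> * ennreal (Z \<omega>) \<partial>M)"
        proof (rule nn_integral_mono)
          fix \<omega>
          have "?err f \<omega> \<le> ennreal (\<alpha> + \<gamma> * Z \<omega>)"
            unfolding lam n \<alpha>_def \<gamma>_def
            by (rule sup_norm_le, rule estimator_error[OF assms f K100 m5 Z])
          then show "?err f \<omega> \<le> ennreal \<alpha> + ennreal \<gamma> * ennreal (Z \<omega>)"
            using ag Z0 by (simp add: ennreal_plus ennreal_mult)
        qed
        also have "\<dots> = ennreal \<alpha> + ennreal \<gamma> * (\<integral>\<^sup>+\<omega>. ennreal (Z \<omega>) \<partial>M)"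
          by (simp add: nn_integral_add nn_integral_cmult emeasure_space_1)
        also have "\<dots> \<le> ennreal \<alpha> + ennreal \<gamma> * ennreal \<zeta>"
          unfolding \<zeta>_def by (intro add_left_mono mult_left_mono EZ) auto
        also have "\<dots> = ennreal (\<alpha> + \<gamma> * \<zeta>)" using ag \<zeta>0 by (simp add: ennreal_plus ennreal_mult)
        also have "\<alpha> + \<gamma> * \<zeta> \<le> (122 * L + 110 * \<sigma>) * \<rho>"
        proof -
          have "\<alpha> \<le> 122 * L * \<rho>" unfolding \<alpha>_def using \<rho>1 assms by (intro mult_left_mono) auto
          moreover have "55 / 2 * \<sigma> * (\<zeta> / real m) \<le> 55 / 2 * \<sigma> * (4 * \<rho>)"
            using \<zeta> assms by (intro mult_left_mono) auto
          ultimately show ?thesis by (simp add: \<gamma>_def algebra_simps)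
        qed
        finally show ?thesis by (simp add: ennreal_leI)
      qed
      show "(\<forall>f\<in>convex_holder r L. ?err f \<in> borel_measurable M) \<and>
         (SUP f\<in>convex_holder r L. \<integral>\<^sup>+\<omega>. ?err f \<omega> \<partial>M)
          \<le> ennreal ((122 * L + 110 * \<sigma>) * (ln (real n) / real n) powr (r / (2 * r + 1)))"
      proof
        show "\<forall>f\<in>convex_holder r L. ?err f \<in> borel_measurable M"
          using sup_norm_error_measurable[OF _ KK(1,3) e[unfolded n]] unfolding lam n by blast
        show "(SUP f\<in>convex_holder r L. \<integral>\<^sup>+\<omega>. ?err f \<omega> \<partial>M)
          \<le> ennreal ((122 * L + 110 * \<sigma>) * (ln (real n) / real n) powr (r / (2 * r + 1)))"
          unfolding \<rho>_def[symmetric] by (rule SUP_least) (rule bound)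
      qed
    qed
  qed
qed

end
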